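(* Let $G$ be a plane ribbon graph. Then $$\Omega(G;-2,1,0,1,\lambda)=P(G;\lambda),$$ where $P(G;\lambda)$ is the Penrose polynomial.
   Context: **Ribbon graphs.** A ribbon graph $G=(V(G),E(G))$ is a surface with boundary, represented as the union of two sets of discs, a set $V(G)$ of vertices and a set $E(G)$ of edges, such that: (1) the vertices and edges intersect in disjoint line segments; (2) each such line segment lies on the boundary of precisely one vertex and precisely one edge; (3) every edge contains exactly two such line segments. Equivalence is homeomorphism (orientation preserving when orientable) mapping vertices to vertices and edges to edges. A ribbon graph is plane if it has genus zero, i.e. capping off its boundary components with discs yields spheres. Let $e\in E(G)$. *Deletion:* $G\setminus e$ is obtained by removing the edge $e$. *Contraction:* if $u,v$ are the (not necessarily distinct) vertices incident with $e$, consider the boundary component(s) of $e\cup\{u,v\}$ as curves on $G$; for each curve attach a disc (a new vertex) by identifying its boundary with the curve, and then delete $e,u,v$; the result is $G/e$. *Partial Petrial:* $G^{\tau(e)}$ is obtained by detaching one end of $e$ from its incident vertex $v$, creating arcs $[a,b]$ on $v$ and $[a',b']$ on $e$ (so that $G$ is recovered by identifying $[a,b]$ with $[a',b']$), and reattaching by identifying $[a,b]$ with $[b',a']$ (giving $e$ a half-twist). For $A\subseteq E(G)$, $G^{\tau(A)}$ is the result of doing this for every edge in $A$. *Penrose-contraction:* $G\rightthreetimes e:=G^{\tau(e)}/e$. **Edge-point ribbon graphs.** An edge-point ribbon graph is an object obtained from a ribbon graph $(V,E)$ by contracting each edge (disc) in some (possibly empty) subset of $E$ to a point; the points so created are singular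 points and the images of the other edges are its edges. Equivalently, it is an edge 2-coloured ribbon graph in which dark grey edges represent those contracted to points and light grey edges are the edges of the edge-point ribbon graph (considered up to partial Petrials of dark grey edges). Ribbon graphs are the edge-point ribbon graphs with no singular points. Deletion, contraction and Penrose-contraction are inherited by performing the ribbon graph operations on light grey edges in the 2-coloured model. $G\odot e$ is obtained by contracting $e$ to a point (recolouring $e$ dark grey). **The polynomial $\Omega$.** $\Omega(G)=\Omega(G;w,x,y,z,t)\in\mathbb{Z}[w,x,y,z,t]$ is the polynomial of edge-point ribbon graphs defined by $\Omega(G)=w\,\Omega(G\odot e)+x\,\Omega(G/e)+y\,\Omega(G\setminus e)+z\,\Omega(G\rightthreetimes e)$ for any edge $e$, and $\Omega(G)=t^{\kappa(G)}$ if $G$ is edgeless, where $\kappa(G)$ is the number of connected components. **The Penrose polynomial.** $P(G;\lambda)=\sum_{A\subseteq E(G)}(-1)^{|A|}\lambda^{f(G^{\tau(A)})}$, where $f(H)$ denotes the number of boundary components of a ribbon graph $H$. *)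

theory Defs
  imports Main "HOL-Library.Poly_Mapping"
begin

section \<open>Ribbon graphs\<close>

text \<open>
  A ribbon graph is given by the cell structure of its surface.  Each edge disc meets the vertex
  discs in exactly two line segments; the four end points of these segments are the
  \<^emph>\<open>flags\<close> of the edge.  The remaining data says how flags are joined by the boundary
  pieces of the discs:

  \<^item> \<open>seg\<close> joins the two ends of a common line segment of a vertex and an edge;
  \<^item> \<open>side\<close> joins the two ends of a free side of an edge disc, so that the
    boundary of an edge disc alternates between \<open>seg\<close> and \<open>side\<close>;
  \<^item> \<open>rim\<close> joins the two ends of a free arc of a vertex disc, so that the
    boundary of a vertex disc alternates between \<open>seg\<close> and \<open>rim\<close>.

  Hence the boundary of the surface alternates between \<open>side\<close> and \<open>rim\<close>.
  A vertex disc meeting no edge has no flags, and only the number \<open>isolated\<close> of such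
  discs is recorded.  The three maps are constrained only on the set of flags.
\<close>

record 'f ribbon =
  flags :: "'f set"
  seg :: "'f \<Rightarrow> 'f"
  side :: "'f \<Rightarrow> 'f"
  rim :: "'f \<Rightarrow> 'f"
  isolated :: nat

definition matching_on :: "'f set \<Rightarrow> ('f \<Rightarrow> 'f) \<Rightarrow> bool" where
  "matching_on F h \<longleftrightarrow> (\<forall>x\<in>F. h x \<in> F \<and> h x \<noteq> x \<and> h (h x) = x)"

text \<open>
  The last condition makes \<open>seg\<close> and \<open>side\<close> run around a 4-cycle on the
  flags of each edge, i.e. every edge disc is attached along exactly two disjoint segments.
\<close>

definition ribbon_graph :: "'f ribbon \<Rightarrow> bool" where
  "ribbon_graph G \<longleftrightarrow>
     finite (flags G) \<and>
     matching_on (flags G) (seg G) \<and>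
     matching_on (flags G) (side G) \<and>
     matching_on (flags G) (rim G) \<and>
     (\<forall>x\<in>flags G. seg G (side G x) = side G (seg G x) \<and> side G x \<noteq> seg G x)"

definition orbits :: "('f \<Rightarrow> 'f) set \<Rightarrow> 'f set \<Rightarrow> 'f set set" where
  "orbits H F = F // {(x, h x) | x h. x \<in> F \<and> h \<in> H}\<^sup>*"

text \<open>Edges, vertices, boundary components and connected components are represented by their
  sets of flags; the isolated vertices have to be added to the last three.\<close>

definition edges :: "'f ribbon \<Rightarrow> 'f set set" where
  "edges G = orbits {seg G, side G} (flags G)"

definition flag_vertices :: "'f ribbon \<Rightarrow> 'f set set" where
  "flag_vertices G = orbits {seg G, rim G} (flags G)"

definition flag_boundaries :: "'f ribbon \<Rightarrow> 'f set set" where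
  "flag_boundaries G = orbits {side G, rim G} (flags G)"

definition flag_components :: "'f ribbon \<Rightarrow> 'f set set" where
  "flag_components G = orbits {seg G, side G, rim G} (flags G)"

definition num_boundaries :: "'f ribbon \<Rightarrow> nat" where
  "num_boundaries G = card (flag_boundaries G) + isolated G"

definition num_components :: "'f ribbon \<Rightarrow> nat" where
  "num_components G = card (flag_components G) + isolated G"

text \<open>The Euler characteristic of the closed surface obtained from the component \<open>C\<close>
  by capping off its boundary components with discs.\<close>

definition capped_euler_char :: "'f ribbon \<Rightarrow> 'f set \<Rightarrow> int" where
  "capped_euler_char G C =
     int (card {v \<in> flag_vertices G. v \<subseteq> C})
     - int (card {e \<in> edges G. e \<subseteq> C})
     + int (card {b \<in> flag_boundaries G. b \<subseteq> C})"

text \<open>Spheres are the connected closed surfaces of Euler characteristic 2.  An isolated vertex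
  is a disc, which always caps off to a sphere.\<close>

definition plane :: "'f ribbon \<Rightarrow> bool" where
  "plane G \<longleftrightarrow> (\<forall>C\<in>flag_components G. capped_euler_char G C = 2)"


section \<open>Deletion, contraction, partial Petrials and Penrose-contraction\<close>

text \<open>
  Consider the closed curves alternating between \<open>h\<close> and \<open>rim\<close>, and make them
  the vertex boundaries (near \<open>e\<close>) of a ribbon graph from which \<open>e\<close> has been
  removed.  The new free arc at a flag \<open>x\<close> follows the curve from \<open>x\<close> until it
  first reaches a flag outside \<open>e\<close>; a curve that only visits flags of \<open>e\<close>
  bounds an isolated vertex.
\<close>

definition new_rim :: "('f \<Rightarrow> 'f) \<Rightarrow> ('f \<Rightarrow> 'f) \<Rightarrow> 'f set \<Rightarrow> 'f \<Rightarrow> 'f" where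
  "new_rim h r e x =
     ((r \<circ> h) ^^ (LEAST n. ((r \<circ> h) ^^ n) (r x) \<notin> e)) (r x)"

definition remove_along :: "('f \<Rightarrow> 'f) \<Rightarrow> 'f ribbon \<Rightarrow> 'f set \<Rightarrow> 'f ribbon" where
  "remove_along h G e =
     G\<lparr>flags := flags G - e,
       rim := new_rim h (rim G) e,
       isolated := isolated G + card {c \<in> orbits {h, rim G} (flags G). c \<subseteq> e}\<rparr>"

text \<open>Deletion keeps the vertex discs.  In a contraction, the new vertices are bounded by the
  boundary curves of the union of \<open>e\<close> with its end vertices; near \<open>e\<close> these
  follow the free sides of \<open>e\<close>.\<close>

definition delete :: "'f ribbon \<Rightarrow> 'f set \<Rightarrow> 'f ribbon" where
  "delete G e = remove_along (seg G) G e"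

definition contract :: "'f ribbon \<Rightarrow> 'f set \<Rightarrow> 'f ribbon" where
  "contract G e = remove_along (side G) G e"

text \<open>A half-twist exchanges the two free sides of an edge at one of its ends.\<close>

definition partial_petrial :: "'f ribbon \<Rightarrow> 'f set set \<Rightarrow> 'f ribbon" where
  "partial_petrial G A =
     G\<lparr>side := (\<lambda>x. if x \<in> \<Union>A then side G (seg G x) else side G x)\<rparr>"

definition penrose_contract :: "'f ribbon \<Rightarrow> 'f set \<Rightarrow> 'f ribbon" where
  "penrose_contract G e = contract (partial_petrial G {e}) e"


section \<open>Edge-point ribbon graphs\<close>

text \<open>
  An edge-point ribbon graph is a ribbon graph with a set of dark edges, namely those that are
  contracted to singular points.  Partial Petrials of dark edges give the same edge-point ribbon
  graph; representatives are not identified here, since the recursion below determines its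
  solution on every representative.
\<close>

type_synonym 'f ep_ribbon = "'f ribbon \<times> 'f set set"

definition ep_ribbon_graph :: "'f ep_ribbon \<Rightarrow> bool" where
  "ep_ribbon_graph = (\<lambda>(G, D). ribbon_graph G \<and> D \<subseteq> edges G)"

definition ep_edges :: "'f ep_ribbon \<Rightarrow> 'f set set" where
  "ep_edges = (\<lambda>(G, D). edges G - D)"

definition ep_components :: "'f ep_ribbon \<Rightarrow> nat" where
  "ep_components = (\<lambda>(G, D). num_components G)"

definition ep_delete :: "'f ep_ribbon \<Rightarrow> 'f set \<Rightarrow> 'f ep_ribbon" where
  "ep_delete = (\<lambda>(G, D) e. (delete G e, D))"

definition ep_contract :: "'f ep_ribbon \<Rightarrow> 'f set \<Rightarrow> 'f ep_ribbon" where
  "ep_contract = (\<lambda>(G, D) e. (contract G e, D))"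

definition ep_penrose_contract :: "'f ep_ribbon \<Rightarrow> 'f set \<Rightarrow> 'f ep_ribbon" where
  "ep_penrose_contract = (\<lambda>(G, D) e. (penrose_contract G e, D))"

definition ep_pinch :: "'f ep_ribbon \<Rightarrow> 'f set \<Rightarrow> 'f ep_ribbon" where
  "ep_pinch = (\<lambda>(G, D) e. (G, insert e D))"

definition of_ribbon :: "'f ribbon \<Rightarrow> 'f ep_ribbon" where
  "of_ribbon G = (G, {})"


section \<open>The polynomial Omega\<close>

datatype indet = Ind_w | Ind_x | Ind_y | Ind_z | Ind_t

text \<open>The ring of integer polynomials in \<open>w, x, y, z, t\<close>, as the monoid ring of the
  monomials.\<close>

type_synonym omega_poly = "(indet \<Rightarrow>\<^sub>0 nat) \<Rightarrow>\<^sub>0 int"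

definition Ind :: "indet \<Rightarrow> omega_poly" where
  "Ind i = Poly_Mapping.single (Poly_Mapping.single i 1) 1"

definition is_Omega :: "('f ep_ribbon \<Rightarrow> omega_poly) \<Rightarrow> bool" where
  "is_Omega \<Phi> \<longleftrightarrow>
     (\<forall>K. ep_ribbon_graph K \<longrightarrow>
        (ep_edges K = {} \<longrightarrow> \<Phi> K = Ind Ind_t ^ ep_components K) \<and>
        (\<forall>e\<in>ep_edges K.
           \<Phi> K = Ind Ind_w * \<Phi> (ep_pinch K e) + Ind Ind_x * \<Phi> (ep_contract K e)
               + Ind Ind_y * \<Phi> (ep_delete K e) + Ind Ind_z * \<Phi> (ep_penrose_contract K e)))"

text \<open>The description is proper only if the recursion has a solution and all its solutions agree
  at \<open>K\<close>, so results about \<open>Omega\<close> include its independence of the order in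
  which edges are processed.\<close>

definition Omega :: "'f ep_ribbon \<Rightarrow> omega_poly" where
  "Omega K = (THE p. \<exists>\<Phi>. is_Omega \<Phi> \<and> \<Phi> K = p)"

definition eval_omega_poly :: "(indet \<Rightarrow> 'a::comm_ring_1) \<Rightarrow> omega_poly \<Rightarrow> 'a" where
  "eval_omega_poly s p =
     (\<Sum>m\<in>Poly_Mapping.keys p. of_int (Poly_Mapping.lookup p m) *
        (\<Prod>i\<in>Poly_Mapping.keys m. s i ^ Poly_Mapping.lookup m i))"

definition Omega_at ::
  "'f ep_ribbon \<Rightarrow> 'a::comm_ring_1 \<Rightarrow> 'a \<Rightarrow> 'a \<Rightarrow> 'a \<Rightarrow> 'a \<Rightarrow> 'a" where
  "Omega_at K w x y z t =
     eval_omega_poly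
       (\<lambda>i. case i of Ind_w \<Rightarrow> w | Ind_x \<Rightarrow> x | Ind_y \<Rightarrow> y | Ind_z \<Rightarrow> z | Ind_t \<Rightarrow> t)
       (Omega K)"


section \<open>The Penrose polynomial\<close>

text \<open>The argument may be any element of a commutative ring; the indeterminate of a polynomial
  ring over the integers gives the polynomial itself.\<close>

definition penrose :: "'f ribbon \<Rightarrow> 'a::comm_ring_1 \<Rightarrow> 'a" where
  "penrose G l =
     (\<Sum>A\<in>Pow (edges G). (- 1) ^ card A * l ^ num_boundaries (partial_petrial G A))"

end

theory Submission
  imports Defs "HOL-Library.FuncSet"
begin

text \<open>
  Unfolding the recursion for \<open>\<Omega>\<close> at all edges assigns to each
  edge one of four resolutions of its four flags: pinching joins them all, contraction joins them
  along \<open>side\<close>, deletion along \<open>seg\<close>, Penrose-contraction along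
  \<open>side \<circ> seg\<close>.  The flags joined by \<open>rim\<close> and by the resolutions fall into classes,
  the circuits of the state (each isolated vertex counting as one more), and \<open>\<Omega>\<close> is the sum
  over all states of the product of the weights times \<open>t\<close> to the number of circuits (\<open>is_Omega_state_sum\<close>,
  \<open>is_Omega_unique\<close>).  The point to check is that removing an edge keeps the number of circuits
  (\<open>card_classes_remove\<close>).  The Penrose polynomial is the signed sum over the states without
  pinching and deletion (\<open>penrose_eq_circuits\<close>).

  For a set \<open>S\<close> of edges, let \<open>Q S\<close> be the
  sum over sets \<open>B\<close> of edges, with sign \<open>(-1) ^ card B\<close>, of \<open>l\<close> to the number of
  circuits of the state that pinches \<open>B\<close>, Penrose-contracts \<open>S - B\<close> and contracts the
  rest.  Let \<open>w\<close>, \<open>x\<close>, \<open>z\<close> stand for pinching, contracting and Penrose-contracting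
  one edge.  From \<open>-2w + x + z = (x - w) + (z - w)\<close> the left-hand side becomes the sum of all
  \<open>Q S\<close>, and from \<open>x - z = (x - w) - (z - w)\<close> the Penrose polynomial becomes the sum of all
  \<open>(-1) ^ card S * Q S\<close>.  So it suffices that \<open>Q S = 0\<close> for \<open>S\<close> of odd size.

  This is where planarity enters.  The state of \<open>S\<close> without pinching consists of closed curves on
  the spheres obtained by capping off, and they cross exactly at the edges in
  \<open>S\<close>.  Two different closed curves cross evenly often
  (\<open>circuits_cross_evenly\<close>), so if \<open>S\<close> is odd, some curve meets itself at an edge
  (\<open>even_if_no_self_contact\<close>).  Pinching that edge merges nothing, whence the terms of
  \<open>Q S\<close> cancel in pairs (\<open>plane_odd_pinch_sum\<close>).  The even number of crossings rests on the
  vanishing of the first homology modulo 2 of the sphere (\<open>plane_cycle_is_boundary\<close>), which is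
  derived from the Euler characteristic by counting elements of vector spaces over the field with two
  elements.
\<close>

section \<open>Orbits and closed sets\<close>

definition steps :: "('f \<Rightarrow> 'f) set \<Rightarrow> 'f set \<Rightarrow> ('f \<times> 'f) set" where
  "steps H F = {(x, h x) | x h. x \<in> F \<and> h \<in> H}"

lemma orbits_steps: "orbits H F = F // (steps H F)\<^sup>*"
  by (simp add: orbits_def steps_def)

lemma matching_onD:
  assumes "matching_on F h" "x \<in> F"
  shows "h x \<in> F" "h x \<noteq> x" "h (h x) = x"
  using assms by (auto simp: matching_on_def)

lemma sym_steps:
  assumes "\<forall>h\<in>H. matching_on F h"
  shows "sym (steps H F)"
proof (rule symI)
  fix x y assume "(x, y) \<in> steps H F"
  then obtain h where "x \<in> F" "h \<in> H" "y = h x" by (auto simp: steps_def)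
  then show "(y, x) \<in> steps H F"
    using assms by (auto simp: steps_def matching_on_def intro!: exI[of _ h])
qed

lemma class_eq_iff:
  assumes "sym R"
  shows "R\<^sup>* `` {x} = R\<^sup>* `` {y} \<longleftrightarrow> (x, y) \<in> R\<^sup>*"
  using symD[OF sym_rtrancl[OF assms]] by (auto intro: rtrancl_trans)

text \<open>Orbits are the minimal nonempty closed sets.  Unlike the orbits, the closed sets form a
  vector space over the field with two elements, which is what the counting for plane graphs uses.\<close>

definition closed_sets :: "('f \<Rightarrow> 'f) set \<Rightarrow> 'f set \<Rightarrow> 'f set set" where
  "closed_sets H F = {X. X \<subseteq> F \<and> (\<forall>h\<in>H. \<forall>x\<in>X. h x \<in> X)}"

lemma rtrancl_steps_closed:
  assumes "(x, y) \<in> (steps H F)\<^sup>*" "x \<in> X" "X \<in> closed_sets H F"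
  shows "y \<in> X"
  using assms(1,2) by induction (use assms(3) in \<open>auto simp: steps_def closed_sets_def\<close>)

context
  fixes H :: "('f \<Rightarrow> 'f) set" and F :: "'f set"
  assumes match: "\<forall>h\<in>H. matching_on F h"
begin

lemma Union_orbits: "\<Union> (orbits H F) = F"
proof -
  have "F \<in> closed_sets H F"
    using match by (auto simp: closed_sets_def matching_on_def)
  then show ?thesis
    using rtrancl_steps_closed[of _ _ H F F] unfolding orbits_steps quotient_def by auto
qed

lemma orbit_subset: "c \<in> orbits H F \<Longrightarrow> c \<subseteq> F"
  using Union_orbits by auto

lemma orbit_nonempty: "c \<in> orbits H F \<Longrightarrow> c \<noteq> {}"
  unfolding orbits_steps quotient_def by auto

lemma orbit_eqI:
  assumes "c \<in> orbits H F" "d \<in> orbits H F" "x \<in> c" "x \<in> d"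
  shows "c = d"
proof -
  from assms obtain y z where y: "c = (steps H F)\<^sup>* `` {y}" and z: "d = (steps H F)\<^sup>* `` {z}"
    unfolding orbits_steps quotient_def by auto
  with assms have "(y, x) \<in> (steps H F)\<^sup>*" "(z, x) \<in> (steps H F)\<^sup>*" by auto
  then show ?thesis
    unfolding y z using class_eq_iff[OF sym_steps, of H F y x] class_eq_iff[OF sym_steps, of H F z x] match
    by simp
qed

lemma orbit_closed:
  assumes "c \<in> orbits H F"
  shows "c \<in> closed_sets H F"
proof -
  have "h x \<in> c" if "h \<in> H" "x \<in> c" for h x
  proof -
    have "x \<in> F" using orbit_subset[OF assms] that by auto
    with that have "(x, h x) \<in> steps H F" by (auto simp: steps_def)
    with that assms show ?thesis
      unfolding orbits_steps quotient_def by (auto intro: rtrancl_into_rtrancl)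
  qed
  with orbit_subset[OF assms] show ?thesis by (auto simp: closed_sets_def)
qed

lemma orbit_minimal:
  assumes "c \<in> orbits H F" "X \<in> closed_sets H F" "c \<inter> X \<noteq> {}"
  shows "c \<subseteq> X"
proof
  fix z assume z: "z \<in> c"
  from assms obtain x where x: "x \<in> c" "x \<in> X" by auto
  from assms(1) obtain y where y: "c = (steps H F)\<^sup>* `` {y}"
    unfolding orbits_steps quotient_def by auto
  have "sym ((steps H F)\<^sup>*)" using match by (intro sym_rtrancl sym_steps)
  then have "(x, z) \<in> (steps H F)\<^sup>*"
    using x z unfolding y by (auto dest: symD intro: rtrancl_trans)
  then show "z \<in> X" using rtrancl_steps_closed x assms by metis
qed

lemma Union_orbits_closed:
  "\<C> \<subseteq> orbits H F \<Longrightarrow> \<Union> \<C> \<in> closed_sets H F"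
  using orbit_closed unfolding closed_sets_def by blast

lemma closed_eq_Union:
  assumes "X \<in> closed_sets H F"
  shows "X = \<Union> {c \<in> orbits H F. c \<subseteq> X}"
proof -
  have "\<exists>c\<in>orbits H F. x \<in> c \<and> c \<subseteq> X" if "x \<in> X" for x
  proof -
    have "x \<in> \<Union> (orbits H F)" using that assms Union_orbits by (auto simp: closed_sets_def)
    then obtain c where "c \<in> orbits H F" "x \<in> c" by auto
    moreover from this have "c \<subseteq> X" using orbit_minimal[of c X] that assms by auto
    ultimately show ?thesis by auto
  qed
  then show ?thesis by auto
qed

lemma orbits_Union_inject:
  assumes "\<C> \<subseteq> orbits H F" "c \<in> orbits H F" "c \<subseteq> \<Union> \<C>"
  shows "c \<in> \<C>"
proof -
  obtain x where "x \<in> c" using orbit_nonempty assms by blast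
  with assms obtain d where "d \<in> \<C>" "x \<in> d" by auto
  with assms \<open>x \<in> c\<close> show ?thesis using orbit_eqI[of c d x] by auto
qed

lemma finite_orbits: "finite F \<Longrightarrow> finite (orbits H F)"
  using Union_orbits by (metis finite_UnionD)

text \<open>A closed set is an arbitrary union of orbits.\<close>

lemma card_closed_sets:
  assumes "finite F"
  shows "card (closed_sets H F) = 2 ^ card (orbits H F)"
proof -
  have "bij_betw Union (Pow (orbits H F)) (closed_sets H F)"
  proof (rule bij_betwI[where g = "\<lambda>X. {c \<in> orbits H F. c \<subseteq> X}"])
    show "Union \<in> Pow (orbits H F) \<rightarrow> closed_sets H F" using Union_orbits_closed by auto
    show "{c \<in> orbits H F. c \<subseteq> \<Union> \<C>} = \<C>" if "\<C> \<in> Pow (orbits H F)" for \<C>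
      using that orbits_Union_inject[of \<C>] by auto
  qed (use closed_eq_Union in auto)
  then have "card (closed_sets H F) = card (Pow (orbits H F))"
    by (simp add: bij_betw_same_card)
  with assms show ?thesis by (simp add: card_Pow finite_orbits)
qed

lemma sum_card_orbits:
  assumes "finite F"
  shows "(\<Sum>c\<in>orbits H F. card c) = card F"
proof -
  have "card (\<Union> (orbits H F)) = (\<Sum>c\<in>orbits H F. card c)"
  proof (rule card_Union_disjoint)
    show "pairwise disjnt (orbits H F)"
      unfolding pairwise_def disjnt_iff by (metis orbit_eqI)
    show "finite c" if "c \<in> orbits H F" for c
      using orbit_subset[OF that] assms by (rule finite_subset)
  qed
  then show ?thesis by (simp add: Union_orbits)
qed

end

lemma closed_sets_mono: "K \<subseteq> H \<Longrightarrow> closed_sets H F \<subseteq> closed_sets K F"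
  by (auto simp: closed_sets_def)

lemma orbit_of:
  assumes "\<forall>h\<in>H. matching_on F h" "x \<in> F"
  obtains c where "c \<in> orbits H F" "x \<in> c"
  using Union_orbits[of H F] assms by blast

text \<open>Orbits of fewer maps refine orbits of more maps.\<close>

lemma sum_suborbits:
  assumes match: "\<forall>h\<in>H. matching_on F h" and "K \<subseteq> H" "finite F"
  shows "(\<Sum>C\<in>orbits H F. card {v \<in> orbits K F. v \<subseteq> C}) = card (orbits K F)"
proof -
  have matchK: "\<forall>h\<in>K. matching_on F h" using assms by auto
  have "orbits K F = (\<Union>C\<in>orbits H F. {v \<in> orbits K F. v \<subseteq> C})"
  proof (intro equalityI subsetI)
    fix v assume v: "v \<in> orbits K F"
    then obtain x where x: "x \<in> v" using orbit_nonempty[OF matchK] by blast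
    then have "x \<in> F" using orbit_subset[OF matchK v] by auto
    then obtain C where C: "C \<in> orbits H F" "x \<in> C" using orbit_of[OF match] by metis
    then have "C \<in> closed_sets K F"
      using orbit_closed[OF match] closed_sets_mono[OF \<open>K \<subseteq> H\<close>] by blast
    then have "v \<subseteq> C" using orbit_minimal[OF matchK v] x C by blast
    with v C show "v \<in> (\<Union>C\<in>orbits H F. {v \<in> orbits K F. v \<subseteq> C})" by auto
  qed auto
  moreover have "card (\<Union>C\<in>orbits H F. {v \<in> orbits K F. v \<subseteq> C})
      = (\<Sum>C\<in>orbits H F. card {v \<in> orbits K F. v \<subseteq> C})"
  proof (rule card_UN_disjoint)
    show "\<forall>C\<in>orbits H F. \<forall>D\<in>orbits H F. C \<noteq> D \<longrightarrow>
        {v \<in> orbits K F. v \<subseteq> C} \<inter> {v \<in> orbits K F. v \<subseteq> D} = {}"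
    proof (intro ballI impI, rule ccontr)
      fix C D assume CD: "C \<in> orbits H F" "D \<in> orbits H F" "C \<noteq> D"
        and "{v \<in> orbits K F. v \<subseteq> C} \<inter> {v \<in> orbits K F. v \<subseteq> D} \<noteq> {}"
      then obtain v where "v \<in> orbits K F" "v \<subseteq> C" "v \<subseteq> D" by auto
      moreover from this obtain x where "x \<in> v" using orbit_nonempty[OF matchK] by blast
      ultimately show False using orbit_eqI[OF match CD(1,2), of x] CD(3) by auto
    qed
  qed (use finite_orbits[OF match \<open>finite F\<close>] finite_orbits[OF matchK \<open>finite F\<close>] in auto)
  ultimately show ?thesis by simp
qed

text \<open>A fixed-point-free involution pairs off the elements.\<close>

lemma card_matching:
  assumes "matching_on M h" "finite M"
  shows "card M = 2 * card (orbits {h} M)"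
proof -
  have m: "\<forall>k\<in>{h}. matching_on M k" using assms by auto
  have "card c = 2" if c: "c \<in> orbits {h} M" for c
  proof -
    obtain x where x: "x \<in> c" using orbit_nonempty[OF m c] by auto
    then have xM: "x \<in> M" using orbit_subset[OF m c] by auto
    have "{x, h x} \<in> closed_sets {h} M"
      using matching_onD[OF assms(1) xM] xM by (auto simp: closed_sets_def)
    then have "c \<subseteq> {x, h x}" using orbit_minimal[OF m c] x by auto
    moreover have "{x, h x} \<subseteq> c"
      using orbit_closed[OF m c] x by (auto simp: closed_sets_def)
    ultimately show ?thesis using matching_onD[OF assms(1) xM] by (metis card_2_iff subset_antisym)
  qed
  then have "(\<Sum>c\<in>orbits {h} M. card c) = (\<Sum>c\<in>orbits {h} M. 2)" by (intro sum.cong) auto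
  moreover have "(\<Sum>c\<in>orbits {h} M. card c) = card M"
    using m assms(2) by (rule sum_card_orbits)
  ultimately show ?thesis by simp
qed

lemma even_card_matching: "matching_on M h \<Longrightarrow> finite M \<Longrightarrow> even (card M)"
  by (simp add: card_matching[of M h])

lemma matching_on_subset:
  assumes "matching_on F h" "M \<subseteq> F" "\<And>x. x \<in> M \<Longrightarrow> h x \<in> M"
  shows "matching_on M h"
  using assms by (auto simp: matching_on_def)


section \<open>Vector spaces of sets over the field with two elements\<close>

definition sym_diff_space :: "'a set set \<Rightarrow> bool" where
  "sym_diff_space \<X> \<longleftrightarrow> {} \<in> \<X> \<and> (\<forall>X\<in>\<X>. \<forall>Y\<in>\<X>. sym_diff X Y \<in> \<X>)"

definition sum_space :: "'a set set \<Rightarrow> 'a set set \<Rightarrow> 'a set set" where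
  "sum_space \<X> \<Y> = (\<lambda>(X, Y). sym_diff X Y) ` (\<X> \<times> \<Y>)"

lemma sym_diff_space_sum:
  assumes "sym_diff_space \<X>" "sym_diff_space \<Y>"
  shows "sym_diff_space (sum_space \<X> \<Y>)"
proof -
  have "sym_diff A B \<in> sum_space \<X> \<Y>" if A: "A \<in> sum_space \<X> \<Y>" and B: "B \<in> sum_space \<X> \<Y>" for A B
  proof -
    obtain X Y where 1: "A = sym_diff X Y" "X \<in> \<X>" "Y \<in> \<Y>"
      using A by (auto simp: sum_space_def)
    obtain X' Y' where 2: "B = sym_diff X' Y'" "X' \<in> \<X>" "Y' \<in> \<Y>"
      using B by (auto simp: sum_space_def)
    have "sym_diff A B = sym_diff (sym_diff X X') (sym_diff Y Y')" unfolding 1 2 by blast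
    with 1 2 assms show ?thesis unfolding sum_space_def sym_diff_space_def
      by (auto intro!: image_eqI[where x = "(sym_diff X X', sym_diff Y Y')"])
  qed
  moreover have "{} \<in> sum_space \<X> \<Y>"
    using assms unfolding sum_space_def sym_diff_space_def by force
  ultimately show ?thesis unfolding sym_diff_space_def by blast
qed

text \<open>The dimension formula for a sum of two subspaces, with cardinalities for dimensions:
  each fibre of the addition map is a translate of the intersection.\<close>

lemma card_sum_space:
  assumes X: "sym_diff_space \<X>" "finite \<X>" and Y: "sym_diff_space \<Y>" "finite \<Y>"
  shows "card (sum_space \<X> \<Y>) * card (\<X> \<inter> \<Y>) = card \<X> * card \<Y>"
proof -
  let ?f = "\<lambda>(X, Y). sym_diff X Y"
  have fibre: "card {p \<in> \<X> \<times> \<Y>. ?f p = Z} = card (\<X> \<inter> \<Y>)"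
    if "Z \<in> ?f ` (\<X> \<times> \<Y>)" for Z
  proof -
    from that obtain A B where AB: "A \<in> \<X>" "B \<in> \<Y>" "Z = sym_diff A B" by auto
    have "bij_betw (\<lambda>W. (sym_diff A W, sym_diff B W)) (\<X> \<inter> \<Y>) {p \<in> \<X> \<times> \<Y>. ?f p = Z}"
    proof (rule bij_betwI[where g = "\<lambda>(X, Y). sym_diff A X"])
      show "(\<lambda>W. (sym_diff A W, sym_diff B W)) \<in> \<X> \<inter> \<Y> \<rightarrow> {p \<in> \<X> \<times> \<Y>. ?f p = Z}"
        using AB X(1) Y(1) unfolding sym_diff_space_def by auto
      have "sym_diff A U \<in> \<Y>" if "U \<in> \<X>" "V \<in> \<Y>" "sym_diff U V = Z" for U V
      proof -
        have "sym_diff A U = sym_diff B V" using that AB(3) by blast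
        then show ?thesis using AB Y(1) that unfolding sym_diff_space_def by simp
      qed
      then show "(\<lambda>(X, Y). sym_diff A X) \<in> {p \<in> \<X> \<times> \<Y>. ?f p = Z} \<rightarrow> \<X> \<inter> \<Y>"
        using AB X(1) unfolding sym_diff_space_def by auto
    qed (use AB in auto)
    then show ?thesis by (simp add: bij_betw_same_card)
  qed
  have "card \<X> * card \<Y> = card (\<X> \<times> \<Y>)" by (simp add: card_cartesian_product)
  also have "\<dots> = (\<Sum>p\<in>\<X> \<times> \<Y>. 1)" by simp
  also have "\<dots> = (\<Sum>Z\<in>?f ` (\<X> \<times> \<Y>). \<Sum>p\<in>{p \<in> \<X> \<times> \<Y>. ?f p = Z}. 1)"
    by (rule sum.image_gen) (use X Y in auto)
  also have "\<dots> = (\<Sum>Z\<in>?f ` (\<X> \<times> \<Y>). card (\<X> \<inter> \<Y>))"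
    by (rule sum.cong) (use fibre in auto)
  finally show ?thesis by (simp add: sum_space_def)
qed

lemma even_card_sym_diff:
  assumes "finite A" "finite B"
  shows "even (card (sym_diff A B)) \<longleftrightarrow> (even (card A) \<longleftrightarrow> even (card B))"
proof -
  have "card A = card (A - B) + card (A \<inter> B)" "card B = card (B - A) + card (A \<inter> B)"
    using assms by (metis card_Diff_subset_Int card_Int_Diff finite_Int add.commute inf_commute)+
  moreover have "card (sym_diff A B) = card (A - B) + card (B - A)"
    using assms by (intro card_Un_disjoint) auto
  ultimately show ?thesis by auto
qed

lemma even_card_Int_sym_diff:
  assumes "finite X"
  shows "even (card (X \<inter> sym_diff A B)) \<longleftrightarrow> (even (card (X \<inter> A)) \<longleftrightarrow> even (card (X \<inter> B)))"
proof -
  have "X \<inter> sym_diff A B = sym_diff (X \<inter> A) (X \<inter> B)" by blast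
  with assms show ?thesis using even_card_sym_diff[of "X \<inter> A" "X \<inter> B"] by simp
qed

definition perp :: "'a set \<Rightarrow> 'a set set \<Rightarrow> 'a set set" where
  "perp F \<W> = {X. X \<subseteq> F \<and> (\<forall>W\<in>\<W>. even (card (X \<inter> W)))}"

text \<open>Orthogonality of characters: translating the summation index by a member of odd
  intersection reverses all signs.\<close>

lemma character_sum:
  assumes W: "sym_diff_space \<W>" and X: "finite X"
  shows "(\<Sum>W\<in>\<W>. (-1::int) ^ card (X \<inter> W))
    = (if \<forall>W\<in>\<W>. even (card (X \<inter> W)) then int (card \<W>) else 0)"
proof (cases "\<forall>W\<in>\<W>. even (card (X \<inter> W))")
  case True
  then have "(\<Sum>W\<in>\<W>. (-1::int) ^ card (X \<inter> W)) = (\<Sum>W\<in>\<W>. 1)" by (intro sum.cong) auto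
  with True show ?thesis by simp
next
  case False
  then obtain U where U: "U \<in> \<W>" "odd (card (X \<inter> U))" by auto
  have "(\<Sum>W\<in>\<W>. (-1::int) ^ card (X \<inter> W)) = (\<Sum>W\<in>\<W>. - ((-1) ^ card (X \<inter> W)))"
  proof (rule sum.reindex_bij_witness[where i = "\<lambda>W. sym_diff W U" and j = "\<lambda>W. sym_diff W U"])
    fix W assume "W \<in> \<W>"
    show "- ((-1::int) ^ card (X \<inter> sym_diff W U)) = (-1) ^ card (X \<inter> W)"
      using even_card_Int_sym_diff[OF X, of W U] U(2)
      by (cases "even (card (X \<inter> W))") auto
  qed (use W U in \<open>auto simp: sym_diff_space_def\<close>)
  then have "(\<Sum>W\<in>\<W>. (-1::int) ^ card (X \<inter> W)) = 0" by (simp add: sum_negf)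
  then show ?thesis unfolding if_not_P[OF False] .
qed

text \<open>Double counting of the sum of \<open>(-1) ^ card (X \<inter> W)\<close> over \<open>X \<subseteq> F\<close> and
  \<open>W \<in> \<W>\<close>: summing over \<open>W\<close> first leaves the members of the orthogonal space,
  summing over \<open>X\<close> first leaves \<open>W = {}\<close>.\<close>

lemma card_perp:
  assumes W: "sym_diff_space \<W>" "\<W> \<subseteq> Pow F" and F: "finite F"
  shows "card \<W> * card (perp F \<W>) = 2 ^ card F"
proof -
  have fin: "finite \<W>" using W F finite_subset by auto
  have "int (card \<W> * card (perp F \<W>)) = (\<Sum>X\<in>perp F \<W>. int (card \<W>))" by simp
  also have "\<dots> = (\<Sum>X\<in>Pow F. if \<forall>W\<in>\<W>. even (card (X \<inter> W)) then int (card \<W>) else 0)"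
    using F by (intro sum.mono_neutral_cong_left) (auto simp: perp_def)
  also have "\<dots> = (\<Sum>X\<in>Pow F. \<Sum>W\<in>\<W>. (-1) ^ card (X \<inter> W))"
    using F by (intro sum.cong refl character_sum[OF W(1), symmetric]) (auto intro: finite_subset)
  also have "\<dots> = (\<Sum>W\<in>\<W>. \<Sum>X\<in>Pow F. (-1) ^ card (W \<inter> X))"
    by (subst sum.swap) (simp add: Int_commute)
  also have "\<dots> = (\<Sum>W\<in>\<W>. if W = {} then 2 ^ card F else 0)"
  proof (rule sum.cong[OF refl])
    fix W assume "W \<in> \<W>"
    then have WF: "W \<subseteq> F" using W by auto
    have "(\<forall>X\<in>Pow F. even (card (W \<inter> X))) \<longleftrightarrow> W = {}"
    proof
      assume ev: "\<forall>X\<in>Pow F. even (card (W \<inter> X))"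
      show "W = {}"
      proof (rule ccontr)
        assume "W \<noteq> {}"
        then obtain a where "a \<in> W" by auto
        with ev WF have "even (card (W \<inter> {a}))" by blast
        with \<open>a \<in> W\<close> show False by simp
      qed
    qed simp
    moreover have "sym_diff_space (Pow F)" by (auto simp: sym_diff_space_def)
    ultimately show "(\<Sum>X\<in>Pow F. (-1) ^ card (W \<inter> X)) = (if W = {} then 2 ^ card F else (0::int))"
      using character_sum[of "Pow F" W] finite_subset[OF WF F] F by (simp add: card_Pow)
  qed
  also have "\<dots> = 2 ^ card F" using W fin by (simp add: sym_diff_space_def)
  finally show ?thesis by (metis of_nat_eq_iff of_nat_numeral of_nat_power)
qed

lemma sym_diff_space_closed_sets:
  assumes "\<forall>h\<in>H. matching_on F h"
  shows "sym_diff_space (closed_sets H F)"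
proof -
  have "sym_diff X Y \<in> closed_sets H F" if X: "X \<in> closed_sets H F" and Y: "Y \<in> closed_sets H F" for X Y
  proof -
    have "h x \<in> Z \<longleftrightarrow> x \<in> Z" if "h \<in> H" "x \<in> F" "Z \<in> closed_sets H F" for h x Z
      using that matching_onD[of F h x] assms by (metis (no_types, lifting) closed_sets_def mem_Collect_eq)
    with X Y show ?thesis unfolding closed_sets_def by blast
  qed
  then show ?thesis by (auto simp: sym_diff_space_def closed_sets_def)
qed

section \<open>Edges and partial Petrials\<close>

definition edge_of :: "'f ribbon \<Rightarrow> 'f \<Rightarrow> 'f set" where
  "edge_of G x = {x, seg G x, side G x, seg G (side G x)}"

context
  fixes G :: "'f ribbon"
  assumes G: "ribbon_graph G"
begin

lemma finite_flags: "finite (flags G)"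
  and match_seg: "matching_on (flags G) (seg G)"
  and match_side: "matching_on (flags G) (side G)"
  and match_rim: "matching_on (flags G) (rim G)"
  and seg_side: "x \<in> flags G \<Longrightarrow> seg G (side G x) = side G (seg G x)"
  and side_neq_seg: "x \<in> flags G \<Longrightarrow> side G x \<noteq> seg G x"
  using G by (auto simp: ribbon_graph_def)

lemma edge_of_closed: "x \<in> flags G \<Longrightarrow> edge_of G x \<in> closed_sets {seg G, side G} (flags G)"
  using match_seg match_side seg_side by (auto simp: edge_of_def closed_sets_def matching_on_def)

lemma match_edges: "\<forall>h\<in>{seg G, side G}. matching_on (flags G) h"
  using match_seg match_side by auto

lemmas edges_orbit =
  orbit_subset[where H = "{seg G, side G}" and F = "flags G", OF match_edges, folded edges_def]
  orbit_nonempty[where H = "{seg G, side G}" and F = "flags G", OF match_edges, folded edges_def]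
  orbit_closed[where H = "{seg G, side G}" and F = "flags G", OF match_edges, folded edges_def]
  orbit_minimal[where H = "{seg G, side G}" and F = "flags G", OF match_edges, folded edges_def]
  orbit_eqI[where H = "{seg G, side G}" and F = "flags G", OF match_edges, folded edges_def]
  orbit_of[where H = "{seg G, side G}" and F = "flags G", OF match_edges, folded edges_def]
  Union_orbits[where H = "{seg G, side G}" and F = "flags G", OF match_edges, folded edges_def]

lemma edges_eq: "edges G = edge_of G ` flags G"
proof -
  have eq: "e = edge_of G x" if e: "e \<in> edges G" "x \<in> e" for e x
  proof
    have x: "x \<in> flags G" using edges_orbit(1) e by auto
    then show "e \<subseteq> edge_of G x"
      using edges_orbit(4)[OF e(1) edge_of_closed[OF x]] e(2) by (auto simp: edge_of_def)
    show "edge_of G x \<subseteq> e"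
      using edges_orbit(3)[OF e(1)] e(2) by (auto simp: edge_of_def closed_sets_def)
  qed
  show ?thesis
  proof (intro equalityI subsetI)
    fix e assume e: "e \<in> edges G"
    then obtain x where x: "x \<in> e" using edges_orbit(2) by blast
    then have "x \<in> flags G" using edges_orbit(1) e by auto
    with eq[OF e x] show "e \<in> edge_of G ` flags G" by auto
  next
    fix e assume "e \<in> edge_of G ` flags G"
    then obtain x where x: "x \<in> flags G" "e = edge_of G x" by auto
    then obtain e' where "e' \<in> edges G" "x \<in> e'" using edges_orbit(6) by metis
    with eq x show "e \<in> edges G" by simp
  qed
qed

lemma edge_of_self: "x \<in> edge_of G x"
  by (simp add: edge_of_def)

lemma edge_subset: "e \<in> edges G \<Longrightarrow> e \<subseteq> flags G"
  by (rule edges_orbit(1))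

lemma edges_disjoint: "e \<in> edges G \<Longrightarrow> d \<in> edges G \<Longrightarrow> x \<in> e \<Longrightarrow> x \<in> d \<Longrightarrow> e = d"
  by (rule edges_orbit(5))

lemma edge_of_eq:
  assumes "e \<in> edges G" "x \<in> e"
  shows "edge_of G x = e"
proof -
  have "x \<in> flags G" using edge_subset assms by auto
  then have "edge_of G x \<in> edges G" by (simp add: edges_eq)
  then show ?thesis using edges_disjoint assms edge_of_self by metis
qed

lemma edge_closed: "e \<in> edges G \<Longrightarrow> x \<in> e \<Longrightarrow> seg G x \<in> e \<and> side G x \<in> e"
  using edges_orbit(3) unfolding closed_sets_def by blast

lemma Union_edges: "\<Union> (edges G) = flags G"
  by (rule edges_orbit(7))

lemma finite_edges: "finite (edges G)"
  by (simp add: edges_eq finite_flags)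

lemma card_edge:
  assumes "e \<in> edges G"
  shows "card e = 4"
proof -
  obtain x where x: "x \<in> flags G" "e = edge_of G x" using assms by (auto simp: edges_eq)
  have 1: "seg G x \<in> flags G" "side G x \<in> flags G" "seg G x \<noteq> x" "side G x \<noteq> x"
    using matching_onD[OF match_seg x(1)] matching_onD[OF match_side x(1)] by auto
  have 2: "seg G (side G x) \<noteq> x"
    using matching_onD[OF match_seg x(1)] matching_onD[OF match_seg 1(2)] side_neq_seg[OF x(1)]
    by metis
  have 3: "seg G (side G x) \<noteq> side G x" "seg G (side G x) \<noteq> seg G x"
    using matching_onD[OF match_seg x(1)] matching_onD[OF match_seg 1(2)] 1 by metis+
  from 1 2 3 side_neq_seg[OF x(1)] show ?thesis
    unfolding x(2) edge_of_def by (simp add: eq_commute)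
qed

lemma card_Union_edges:
  assumes "S \<subseteq> edges G"
  shows "card (\<Union> S) = 4 * card S"
proof -
  have "card (\<Union> S) = (\<Sum>e\<in>S. card e)"
  proof (rule card_Union_disjoint)
    show "pairwise disjnt S"
      using assms edges_disjoint unfolding pairwise_def disjnt_iff by (metis subsetD)
    show "finite e" if "e \<in> S" for e
      using that assms edge_subset finite_flags by (meson finite_subset subsetD)
  qed
  also have "\<dots> = (\<Sum>e\<in>S. 4)" using assms card_edge by (intro sum.cong) auto
  finally show ?thesis by simp
qed

end

lemma petrial_sel [simp]:
  "flags (partial_petrial G A) = flags G" "seg (partial_petrial G A) = seg G"
  "rim (partial_petrial G A) = rim G" "isolated (partial_petrial G A) = isolated G"
  by (simp_all add: partial_petrial_def)

lemma petrial_side: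
  "side (partial_petrial G A) x = (if x \<in> \<Union> A then side G (seg G x) else side G x)"
  by (simp add: partial_petrial_def)

lemma Union_edges_closed:
  assumes "ribbon_graph G" "A \<subseteq> edges G" "x \<in> flags G"
  shows "seg G x \<in> \<Union> A \<longleftrightarrow> x \<in> \<Union> A" "side G x \<in> \<Union> A \<longleftrightarrow> x \<in> \<Union> A"
proof -
  have "seg G y \<in> \<Union> A \<and> side G y \<in> \<Union> A" if "y \<in> \<Union> A" for y
    using that edge_closed[OF assms(1)] assms(2) by (meson Union_iff subsetD)
  from this[of x] this[of "seg G x"] this[of "side G x"]
  show "seg G x \<in> \<Union> A \<longleftrightarrow> x \<in> \<Union> A" "side G x \<in> \<Union> A \<longleftrightarrow> x \<in> \<Union> A"
    using matching_onD(3)[OF match_seg[OF assms(1)] assms(3)]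
      matching_onD(3)[OF match_side[OF assms(1)] assms(3)] by metis+
qed

lemma ribbon_graph_petrial:
  assumes G: "ribbon_graph G" and A: "A \<subseteq> edges G"
  shows "ribbon_graph (partial_petrial G A)"
proof -
  let ?F = "flags G"
  have seg: "seg G x \<in> ?F" "seg G x \<noteq> x" "seg G (seg G x) = x" if "x \<in> ?F" for x
    using matching_onD[OF match_seg[OF G] that] .
  have side: "side G x \<in> ?F" "side G x \<noteq> x" "side G (side G x) = x" if "x \<in> ?F" for x
    using matching_onD[OF match_side[OF G] that] .
  have com: "seg G (side G x) = side G (seg G x)" "side G x \<noteq> seg G x" if "x \<in> ?F" for x
    using seg_side[OF G that] side_neq_seg[OF G that] .
  have cl: "seg G x \<in> \<Union> A \<longleftrightarrow> x \<in> \<Union> A" "side G x \<in> \<Union> A \<longleftrightarrow> x \<in> \<Union> A"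
    if "x \<in> ?F" for x
    using Union_edges_closed[OF G A that] .
  have ne: "side G (seg G x) \<noteq> x" if "x \<in> ?F" for x
    using that seg side com by metis
  have ne2: "side G (seg G x) \<noteq> seg G x" if "x \<in> ?F" for x
    using that seg side by metis
  have "side (partial_petrial G A) x \<in> ?F \<and> side (partial_petrial G A) x \<noteq> x
      \<and> side (partial_petrial G A) (side (partial_petrial G A) x) = x
      \<and> seg G (side (partial_petrial G A) x) = side (partial_petrial G A) (seg G x)
      \<and> side (partial_petrial G A) x \<noteq> seg G x" if "x \<in> ?F" for x
    using that seg side com cl ne ne2 by (cases "x \<in> \<Union> A") (simp_all add: petrial_side del: Union_iff)
  then show ?thesis
    unfolding ribbon_graph_def matching_on_def
    using finite_flags[OF G] seg match_rim[OF G] by (auto simp: matching_on_def)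
qed

lemma edges_petrial:
  assumes G: "ribbon_graph G" and A: "A \<subseteq> edges G"
  shows "edges (partial_petrial G A) = edges G"
proof -
  have "edge_of (partial_petrial G A) x = edge_of G x" if "x \<in> flags G" for x
  proof -
    have "seg G (side G (seg G x)) = side G x"
      using that seg_side[OF G that] matching_onD[OF match_seg[OF G]] matching_onD(1)[OF match_side[OF G]]
      by metis
    then show ?thesis using seg_side[OF G that] by (auto simp: edge_of_def petrial_side)
  qed
  then show ?thesis
    by (simp add: edges_eq[OF G] edges_eq[OF ribbon_graph_petrial[OF G A]])
qed

section \<open>Cycles of the medial graph of a plane graph\<close>

text \<open>Every vertex, edge and boundary component with flags lies in exactly one component, so the
  Euler characteristics of the components add up.\<close>

lemma plane_euler_sum:
  assumes G: "ribbon_graph G" and "plane G"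
  shows "card (flag_vertices G) + card (flag_boundaries G)
    = card (edges G) + 2 * card (flag_components G)"
proof -
  let ?H = "{seg G, side G, rim G}" and ?F = "flags G"
  have match: "\<forall>h\<in>?H. matching_on ?F h"
    using match_seg[OF G] match_side[OF G] match_rim[OF G] by auto
  have sub: "(\<Sum>C\<in>flag_components G. int (card {v \<in> orbits K ?F. v \<subseteq> C})) = int (card (orbits K ?F))"
    if "K \<subseteq> ?H" for K
    using sum_suborbits[OF match that finite_flags[OF G]] unfolding flag_components_def
    by (simp flip: of_nat_sum)
  have "(\<Sum>C\<in>flag_components G. capped_euler_char G C) = (\<Sum>C\<in>flag_components G. 2)"
    using assms(2) by (intro sum.cong) (auto simp: plane_def)
  then have "int (card (flag_vertices G)) - int (card (edges G)) + int (card (flag_boundaries G))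
      = 2 * int (card (flag_components G))"
    unfolding capped_euler_char_def sum.distrib sum_subtractf flag_vertices_def edges_def flag_boundaries_def
    by (simp add: sub)
  then show ?thesis by linarith
qed

text \<open>The edges of the medial graph are the free vertex arcs, that is, the pairs joined by
  \<open>rim\<close>; each separates a vertex from a boundary component.  A union \<open>C\<close> of arcs that
  meets every edge evenly is a cycle modulo 2 of the medial graph, and \<open>X\<close> and \<open>Y\<close> are the
  vertices and the boundary components on one side of it.

  For the proof, the cycles are the sets orthogonal to the rim-closed sets and to the unions of
  edges.  With \<open>k\<close> components and \<open>e\<close> edges these two spaces have dimensions \<open>2e\<close> and
  \<open>e\<close> inside the space of dimension \<open>4e\<close>, and their intersection has dimension \<open>k\<close>;
  so the cycles have dimension \<open>e + k\<close>.  The sets \<open>sym_diff X Y\<close> are cycles and form a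
  space of dimension \<open>V + B - k\<close>, where \<open>V\<close> and \<open>B\<close> count the vertices and the boundary
  components with flags.  By Euler's formula the dimensions agree.\<close>

lemma plane_cycle_is_boundary:
  assumes G: "ribbon_graph G" and pl: "plane G"
    and C: "C \<in> closed_sets {rim G} (flags G)"
    and even: "\<And>E. E \<in> closed_sets {seg G, side G} (flags G) \<Longrightarrow> even (card (C \<inter> E))"
  obtains X Y where "X \<in> closed_sets {seg G, rim G} (flags G)"
    "Y \<in> closed_sets {side G, rim G} (flags G)" "C = sym_diff X Y"
proof -
  let ?F = "flags G"
  let ?V = "closed_sets {seg G, rim G} ?F" and ?B = "closed_sets {side G, rim G} ?F"
  let ?R = "closed_sets {rim G} ?F" and ?E = "closed_sets {seg G, side G} ?F"
  let ?K = "closed_sets {seg G, side G, rim G} ?F"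
  let ?k = "card (flag_components G)" and ?e = "card (edges G)"
  note m = match_seg[OF G] match_side[OF G] match_rim[OF G]
  note fin = finite_flags[OF G]
  have ev: "even (card (X \<inter> Y))" if "h \<in> {seg G, side G, rim G}" "h \<in> H" "h \<in> K"
      "X \<in> closed_sets H ?F" "Y \<in> closed_sets K ?F" for h H K X Y
  proof -
    have sub: "X \<inter> Y \<subseteq> ?F" using that(4) by (auto simp: closed_sets_def)
    have "matching_on ?F h" using that(1) m by auto
    moreover have "h x \<in> X \<inter> Y" if "x \<in> X \<inter> Y" for x
      using that \<open>h \<in> H\<close> \<open>h \<in> K\<close> \<open>X \<in> _\<close> \<open>Y \<in> _\<close> by (simp add: closed_sets_def)
    ultimately have "matching_on (X \<inter> Y) h" using sub matching_on_subset by metis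
    from card_matching[OF this finite_subset[OF sub fin]] show ?thesis by simp
  qed
  have sp: "sym_diff_space ?V" "sym_diff_space ?B" "sym_diff_space ?R" "sym_diff_space ?E"
    by (rule sym_diff_space_closed_sets, use m in auto)+
  have fins: "finite (closed_sets H ?F)" for H
    by (rule finite_subset[of _ "Pow ?F"]) (use fin in \<open>auto simp: closed_sets_def\<close>)
  have Z: "sum_space ?V ?B \<subseteq> perp ?F (sum_space ?R ?E)"
  proof -
    have "even (card (sym_diff X Y \<inter> sym_diff R E))"
      if "X \<in> ?V" "Y \<in> ?B" "R \<in> ?R" "E \<in> ?E" for X Y R E
    proof -
      have "finite X" "finite Y" "finite (sym_diff R E)"
        using that fin finite_subset by (auto simp: closed_sets_def)
      moreover have "even (card (X \<inter> R))" "even (card (X \<inter> E))" "even (card (Y \<inter> R))" "even (card (Y \<inter> E))"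
        using that ev[of "rim G" "{seg G, rim G}" "{rim G}" X R]
          ev[of "seg G" "{seg G, rim G}" "{seg G, side G}" X E]
          ev[of "rim G" "{side G, rim G}" "{rim G}" Y R]
          ev[of "side G" "{side G, rim G}" "{seg G, side G}" Y E] by simp_all
      ultimately have "even (card (X \<inter> sym_diff R E))" "even (card (Y \<inter> sym_diff R E))"
        by (simp_all only: even_card_Int_sym_diff)
      then show ?thesis
        using even_card_Int_sym_diff[OF \<open>finite (sym_diff R E)\<close>, of X Y]
        by (simp only: Int_commute[of "sym_diff R E"])
    qed
    moreover have "sum_space ?V ?B \<subseteq> Pow ?F" by (auto simp: sum_space_def closed_sets_def)
    ultimately show ?thesis unfolding perp_def by (fastforce simp: sum_space_def)
  qed
  have cV: "card ?V = 2 ^ card (flag_vertices G)" "card ?B = 2 ^ card (flag_boundaries G)"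
    "card ?E = 2 ^ ?e" "card ?K = 2 ^ ?k" "card ?R = 2 ^ card (orbits {rim G} ?F)"
    unfolding flag_vertices_def flag_boundaries_def edges_def flag_components_def
    by (rule card_closed_sets, use m fin in auto)+
  have cF: "card ?F = 4 * ?e"
    using card_Union_edges[OF G, of "edges G"] Union_edges[OF G] by simp
  have cR: "card ?R = 2 ^ (2 * ?e)"
    using cV(5) cF card_matching[OF m(3) fin] by simp
  have "?V \<inter> ?B = ?K" "?R \<inter> ?E = ?K" by (auto simp: closed_sets_def)
  then have "card (sum_space ?V ?B) * 2 ^ ?k = 2 ^ (card (flag_vertices G) + card (flag_boundaries G))"
    and R: "card (sum_space ?R ?E) * 2 ^ ?k = 2 ^ (3 * ?e)"
    using card_sum_space[OF sp(1) fins sp(2) fins] card_sum_space[OF sp(3) fins sp(4) fins] cV cR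
    by (simp_all add: power_add[symmetric])
  then have "card (sum_space ?V ?B) * 2 ^ ?k = 2 ^ (?e + ?k) * 2 ^ ?k"
    using plane_euler_sum[OF G pl] by (simp add: power_add[symmetric] mult_2)
  then have P: "card (sum_space ?V ?B) = 2 ^ (?e + ?k)" by simp
  have "sum_space ?R ?E \<subseteq> Pow ?F" by (auto simp: sum_space_def closed_sets_def)
  from card_perp[OF sym_diff_space_sum[OF sp(3,4)] this fin]
  have "card (sum_space ?R ?E) * card (perp ?F (sum_space ?R ?E)) = 2 ^ (4 * ?e)"
    unfolding cF .
  then have "card (sum_space ?R ?E) * 2 ^ ?k * card (perp ?F (sum_space ?R ?E)) = 2 ^ (4 * ?e) * 2 ^ ?k"
    by (simp add: mult_ac)
  then have "2 ^ (3 * ?e) * card (perp ?F (sum_space ?R ?E)) = 2 ^ (4 * ?e) * 2 ^ ?k"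
    unfolding R .
  also have "\<dots> = 2 ^ (3 * ?e) * 2 ^ (?e + ?k)" by (simp add: power_add[symmetric])
  finally have "card (perp ?F (sum_space ?R ?E)) = 2 ^ (?e + ?k)" by simp
  moreover have "finite (perp ?F (sum_space ?R ?E))"
    by (rule finite_subset[of _ "Pow ?F"]) (use fin in \<open>auto simp: perp_def\<close>)
  ultimately have eq: "sum_space ?V ?B = perp ?F (sum_space ?R ?E)"
    using Z P by (intro card_subset_eq) auto
  have "even (card (C \<inter> W))" if W: "W \<in> sum_space ?R ?E" for W
  proof -
    obtain R E where RE: "R \<in> ?R" "E \<in> ?E" "W = sym_diff R E"
      using W unfolding sum_space_def by force
    have "finite C" using C fin finite_subset by (auto simp: closed_sets_def)
    moreover have "even (card (C \<inter> R))" using ev[of "rim G" "{rim G}" "{rim G}" C R] C RE(1) by simp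
    moreover have "even (card (C \<inter> E))" using even RE(2) .
    ultimately show ?thesis unfolding RE(3) by (simp only: even_card_Int_sym_diff)
  qed
  moreover have "C \<subseteq> ?F" using C by (auto simp: closed_sets_def)
  ultimately have "C \<in> sum_space ?V ?B" unfolding eq perp_def by blast
  then obtain X Y where "X \<in> ?V" "Y \<in> ?B" "C = sym_diff X Y"
    unfolding sum_space_def by force
  then show ?thesis using that by blast
qed

text \<open>In a plane graph two disjoint families of circuits of the medial graph cross evenly often.
  Here a circuit follows the free vertex arcs; at an edge in \<open>S\<close> it passes to the opposite
  flag, at the others it runs along a free side.  Write \<open>C\<close> as the boundary between an inside
  and an outside.  Along \<open>U\<close> the side changes exactly at the crossings with \<open>C\<close>, so these
  are even in number; each is counted at its two flags in \<open>U\<close>, whence the 4.\<close>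

lemma circuits_cross_evenly:
  assumes G: "ribbon_graph G" and pl: "plane G" and S: "S \<subseteq> edges G"
    and C: "C \<in> closed_sets {side (partial_petrial G S), rim G} (flags G)"
    and U: "U \<in> closed_sets {side (partial_petrial G S), rim G} (flags G)"
    and disj: "C \<inter> U = {}"
  shows "4 dvd card {x \<in> \<Union> S \<inter> U. seg G x \<in> C}"
proof -
  let ?F = "flags G"
  define s where "s = side (partial_petrial G S)"
  have s: "matching_on ?F s"
    using match_side[OF ribbon_graph_petrial[OF G S]] by (simp add: s_def)
  have s_in: "s x = side G (seg G x)" if "x \<in> \<Union> S" for x using that by (simp add: s_def petrial_side)
  have s_out: "s x = side G x" if "x \<notin> \<Union> S" for x using that by (simp add: s_def petrial_side)
  note fin = finite_flags[OF G]
  note seg = matching_onD[OF match_seg[OF G]] and sd = matching_onD[OF match_side[OF G]]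
  have C: "C \<subseteq> ?F" "\<And>x. x \<in> C \<Longrightarrow> s x \<in> C" "\<And>x. x \<in> C \<Longrightarrow> rim G x \<in> C"
    using C unfolding closed_sets_def s_def by auto
  have U: "U \<subseteq> ?F" "\<And>x. x \<in> U \<Longrightarrow> s x \<in> U" "\<And>x. x \<in> U \<Longrightarrow> rim G x \<in> U"
    using U unfolding closed_sets_def s_def by auto
  have ev: "even (card (C \<inter> E))" if E: "E \<in> closed_sets {seg G, side G} ?F" for E
  proof -
    have "s x \<in> E" if "x \<in> E" for x
      using that E s_in[of x] s_out[of x] by (cases "x \<in> \<Union> S") (auto simp: closed_sets_def)
    then have "matching_on (C \<inter> E) s" using matching_on_subset[OF s, of "C \<inter> E"] C(1,2) by auto
    then show ?thesis using C(1) fin by (meson even_card_matching finite_Int finite_subset)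
  qed
  have "C \<in> closed_sets {rim G} ?F" using C by (auto simp: closed_sets_def)
  then obtain X Y where X: "X \<in> closed_sets {seg G, rim G} ?F"
    and Y: "Y \<in> closed_sets {side G, rim G} ?F" and XY: "C = sym_diff X Y"
    using plane_cycle_is_boundary[OF G pl _ ev] by blast
  have Xseg: "seg G x \<in> X \<longleftrightarrow> x \<in> X" if "x \<in> ?F" for x
  proof -
    have "seg G y \<in> X" if "y \<in> X" for y using X that by (auto simp: closed_sets_def)
    from this[of x] this[of "seg G x"] show ?thesis using seg(3)[OF that] by auto
  qed
  have Yside: "side G x \<in> Y \<longleftrightarrow> x \<in> Y" if "x \<in> ?F" for x
  proof -
    have "side G y \<in> Y" if "y \<in> Y" for y using Y that by (auto simp: closed_sets_def)
    from this[of x] this[of "side G x"] show ?thesis using sd(3)[OF that] by auto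
  qed
  have UXY: "x \<in> X \<longleftrightarrow> x \<in> Y" if "x \<in> U" for x using that disj XY by auto
  have change: "(s x \<in> X \<longleftrightarrow> x \<notin> X) \<longleftrightarrow> x \<in> \<Union> S \<and> seg G x \<in> C" if x: "x \<in> U" for x
  proof -
    have xF: "x \<in> ?F" using x U(1) by auto
    have sX: "s x \<in> X \<longleftrightarrow> s x \<in> Y" using x by (intro UXY U(2))
    show ?thesis
    proof (cases "x \<in> \<Union> S")
      case True
      then have "s x \<in> X \<longleftrightarrow> seg G x \<in> Y" using sX Yside[OF seg(1)[OF xF]] s_in by simp
      moreover have "seg G x \<in> C \<longleftrightarrow> (seg G x \<in> Y \<longleftrightarrow> x \<notin> X)" using XY Xseg[OF xF] by auto
      ultimately show ?thesis using True by blast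
    next
      case False
      then have "s x \<in> X \<longleftrightarrow> x \<in> X" using sX Yside[OF xF] UXY[OF x] s_out by simp
      with False show ?thesis by blast
    qed
  qed
  \<comment> \<open>Of the flags of \<open>U\<close> inside \<open>C\<close>, all are paired off by \<open>rim\<close>, and those not at a crossing by \<open>s\<close>; so
    evenly many are at a crossing.\<close>
  define M where "M = U \<inter> X"
  define M1 where "M1 = {x \<in> M. s x \<notin> M}"
  have finM: "finite M" using U(1) fin finite_subset unfolding M_def by blast
  have ss: "s (s x) = x" if "x \<in> U" for x using that U(1) matching_onD(3)[OF s] by auto
  have "rim G x \<in> M" if "x \<in> M" for x
    using that U(3) X unfolding M_def by (simp add: closed_sets_def)
  then have "matching_on M (rim G)"
    using matching_on_subset[OF match_rim[OF G], of M] U(1) unfolding M_def by blast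
  then have evM: "even (card M)" using even_card_matching finM by blast
  have "s x \<in> M - M1" if "x \<in> M - M1" for x
    using that ss[of x] unfolding M1_def M_def by auto
  then have "matching_on (M - M1) s"
    using matching_on_subset[OF s, of "M - M1"] U(1) unfolding M_def by blast
  then have "even (card (M - M1))" using even_card_matching finM by blast
  moreover have "card M = card (M - M1) + card M1"
    using finM by (metis (no_types, lifting) M1_def add.commute card_Int_Diff inf.absorb_iff2 mem_Collect_eq subsetI)
  ultimately have evM1: "even (card M1)" using evM by simp
  have M1: "x \<in> M1 \<union> s ` M1 \<longleftrightarrow> x \<in> U \<and> (s x \<in> X \<longleftrightarrow> x \<notin> X)" for x
  proof
    assume "x \<in> M1 \<union> s ` M1"
    then show "x \<in> U \<and> (s x \<in> X \<longleftrightarrow> x \<notin> X)"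
      using U(2) ss unfolding M1_def M_def by auto
  next
    assume x: "x \<in> U \<and> (s x \<in> X \<longleftrightarrow> x \<notin> X)"
    show "x \<in> M1 \<union> s ` M1"
    proof (cases "x \<in> X")
      case True
      then show ?thesis using x unfolding M1_def M_def by auto
    next
      case False
      then have "s x \<in> M1" using x U(2) ss unfolding M1_def M_def by auto
      then show ?thesis using ss x by (metis UnI2 imageI)
    qed
  qed
  then have "{x \<in> \<Union> S \<inter> U. seg G x \<in> C} = M1 \<union> s ` M1" using change by blast
  moreover have "card (M1 \<union> s ` M1) = card M1 + card (s ` M1)"
    using finM by (intro card_Un_disjoint) (auto simp: M1_def)
  moreover have "inj_on s M1"
    using ss by (intro inj_on_inverseI[of _ s]) (auto simp: M1_def M_def)
  ultimately have "card {x \<in> \<Union> S \<inter> U. seg G x \<in> C} = 2 * card M1"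
    by (simp add: card_image)
  with evM1 show ?thesis by (auto elim!: evenE)
qed

text \<open>The circuits determined by \<open>S\<close> cross exactly at the edges in \<open>S\<close>.  If no circuit
  meets itself there, every edge in \<open>S\<close> is a crossing of two different circuits, and adding up
  the even numbers of crossings over all pairs of circuits gives an even number.\<close>

lemma even_if_no_self_contact:
  assumes G: "ribbon_graph G" and pl: "plane G" and S: "S \<subseteq> edges G"
    and no_self: "\<And>c x. c \<in> orbits {side (partial_petrial G S), rim G} (flags G) \<Longrightarrow>
      x \<in> c \<Longrightarrow> x \<in> \<Union> S \<Longrightarrow> seg G x \<notin> c"
  shows "even (card S)"
proof -
  let ?F = "flags G" and ?H = "{side (partial_petrial G S), rim G}"
  have P: "ribbon_graph (partial_petrial G S)" using G S by (rule ribbon_graph_petrial)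
  have m: "\<forall>h\<in>?H. matching_on ?F h"
    using match_side[OF P] match_rim[OF G] by simp
  note fin = finite_flags[OF G]
  note seg = matching_onD[OF match_seg[OF G]]
  have finS: "finite (\<Union> S)"
    using S edge_subset[OF G] fin finite_subset by (metis Union_edges[OF G] Union_mono)
  define cr where "cr A B = {x \<in> \<Union> S \<inter> A. seg G x \<in> B}" for A B
  have fcr: "finite (cr A B)" for A B using finS unfolding cr_def by (auto intro: finite_subset[OF _ finS])
  have cr_sym: "card (cr A B) = card (cr B A)" for A B
  proof -
    have "bij_betw (seg G) (cr A B) (cr B A)"
    proof (rule bij_betwI[where g = "seg G"])
      have "seg G x \<in> \<Union> S \<and> seg G (seg G x) = x" if "x \<in> \<Union> S" for x
        using that S Union_edges_closed(1)[OF G S, of x] edge_subset[OF G] seg(3)[of x] by blast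
      then show "seg G \<in> cr A B \<rightarrow> cr B A" "seg G \<in> cr B A \<rightarrow> cr A B"
        "\<And>x. x \<in> cr A B \<Longrightarrow> seg G (seg G x) = x" "\<And>x. x \<in> cr B A \<Longrightarrow> seg G (seg G x) = x"
        by (auto simp: cr_def)
    qed
    then show ?thesis by (rule bij_betw_same_card)
  qed
  \<comment> \<open>Each edge of \<open>S\<close> contributes its four flags, so divisibility by 8 means evenly many edges.\<close>
  have "8 dvd card (cr (\<Union> \<C>) (\<Union> \<C>))" if "finite \<C>" "\<C> \<subseteq> orbits ?H ?F" for \<C>
    using that
  proof (induction \<C> rule: finite_induct)
    case empty
    then show ?case by (simp add: cr_def)
  next
    case (insert c \<C>)
    let ?U = "\<Union> \<C>"
    have c: "c \<in> closed_sets ?H ?F" using orbit_closed[OF m] insert.prems by simp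
    have U: "?U \<in> closed_sets ?H ?F" using Union_orbits_closed[OF m] insert.prems by simp
    have disj: "c \<inter> ?U = {}"
    proof -
      have "d \<notin> \<C>" if "x \<in> c" "x \<in> d" for x d
        using that insert.prems insert.hyps(2) orbit_eqI[OF m, of c d x] by auto
      then show ?thesis by auto
    qed
    have "4 dvd card (cr ?U c)"
      using circuits_cross_evenly[OF G pl S c U disj] by (simp add: cr_def)
    then have 8: "8 dvd card (cr ?U c) + card (cr c ?U)"
      using cr_sym[of c ?U] by presburger
    have "cr (\<Union> (insert c \<C>)) (\<Union> (insert c \<C>)) = cr ?U ?U \<union> (cr ?U c \<union> cr c ?U)"
      using no_self insert.prems unfolding cr_def by auto
    moreover have "card (cr ?U c \<union> cr c ?U) = card (cr ?U c) + card (cr c ?U)"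
      using disj by (intro card_Un_disjoint finite_UnI fcr) (auto simp: cr_def)
    moreover have "card (cr ?U ?U \<union> (cr ?U c \<union> cr c ?U)) = card (cr ?U ?U) + card (cr ?U c \<union> cr c ?U)"
      using disj by (intro card_Un_disjoint finite_UnI fcr) (auto simp: cr_def)
    ultimately show ?case using insert.IH insert.prems 8 by simp
  qed
  from this[OF finite_orbits[OF m fin]] have "8 dvd card (cr ?F ?F)"
    using Union_orbits[OF m] by simp
  moreover have "cr ?F ?F = \<Union> S"
    using S edge_subset[OF G] seg(1) unfolding cr_def by blast
  ultimately have "8 dvd 4 * card S" using card_Union_edges[OF G S] by simp
  then show ?thesis by presburger
qed

section \<open>Removing an edge along its boundary curves\<close>

text \<open>The curve followed in the definition of \<open>new_rim\<close>, including the part after it has left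
  the removed edge.\<close>

definition walk :: "('f \<Rightarrow> 'f) \<Rightarrow> ('f \<Rightarrow> 'f) \<Rightarrow> 'f \<Rightarrow> nat \<Rightarrow> 'f" where
  "walk h r x n = ((r \<circ> h) ^^ n) (r x)"

lemma walk_0: "walk h r x 0 = r x"
  and walk_Suc: "walk h r x (Suc n) = r (h (walk h r x n))"
  by (simp_all add: walk_def)

context
  fixes F e :: "'f set" and h r :: "'f \<Rightarrow> 'f"
  assumes fin: "finite F" and h: "matching_on F h" and r: "matching_on F r"
    and eF: "e \<subseteq> F" and he: "\<forall>x\<in>e. h x \<in> e"
begin

lemma walk_in: "x \<in> F \<Longrightarrow> walk h r x n \<in> F"
  using h r by (induction n) (auto simp: walk_0 walk_Suc matching_on_def)

text \<open>A curve that enters \<open>e\<close> leaves it again: otherwise, \<open>r \<circ> h\<close> being injective,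
  it would return to its first flag in \<open>e\<close> and so have come from inside \<open>e\<close>.\<close>

lemma walk_exits:
  assumes x: "x \<in> F - e"
  shows "\<exists>n. walk h r x n \<notin> e"
proof (rule ccontr)
  assume "\<not> ?thesis"
  then have all: "walk h r x n \<in> e" for n by auto
  then have "range (walk h r x) \<subseteq> e" by auto
  then have "finite (range (walk h r x))" using eF fin finite_subset by metis
  then have "\<not> inj (walk h r x)" using finite_imageD by auto
  then obtain i j where ij: "walk h r x i = walk h r x j" "i \<noteq> j" unfolding inj_def by auto
  have rewind: "walk h r x (k + d) = walk h r x k \<Longrightarrow> walk h r x d = walk h r x 0" for k d
  proof (induction k)
    case (Suc k)
    have "walk h r x (k + d) \<in> F" "walk h r x k \<in> F" using all eF by auto
    moreover have "r (h (walk h r x (k + d))) = r (h (walk h r x k))"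
      using Suc.prems by (simp add: walk_Suc)
    ultimately have "walk h r x (k + d) = walk h r x k"
      using matching_onD(1,3)[OF h] matching_onD(3)[OF r] by metis
    then show ?case by (rule Suc.IH)
  qed simp
  obtain d where d: "walk h r x (Suc d) = r x"
  proof (cases "i < j")
    case True
    then obtain d where "j = i + Suc d" using less_iff_Suc_add by auto
    with ij(1) have "walk h r x (i + Suc d) = walk h r x i" by simp
    from rewind[OF this] show ?thesis by (intro that) (simp add: walk_0)
  next
    case False
    then obtain d where "i = j + Suc d" using ij(2) less_iff_Suc_add by (metis linorder_neqE_nat add_Suc_right)
    with ij(1) have "walk h r x (j + Suc d) = walk h r x j" by simp
    from rewind[OF this] show ?thesis by (intro that) (simp add: walk_0)
  qed
  then have "r (h (walk h r x d)) = r x" by (simp add: walk_Suc)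
  moreover have "h (walk h r x d) \<in> F" using he all eF by auto
  ultimately have "h (walk h r x d) = x"
    using x matching_onD(3)[OF r] by (metis DiffD1)
  then show False using he all x by (metis DiffD2)
qed

definition exit_time :: "'f \<Rightarrow> nat" where
  "exit_time x = (LEAST n. walk h r x n \<notin> e)"

lemma new_rim_walk: "new_rim h r e x = walk h r x (exit_time x)"
  by (simp add: new_rim_def exit_time_def walk_def)

lemma walk_before_exit: "n < exit_time x \<Longrightarrow> walk h r x n \<in> e"
  unfolding exit_time_def using not_less_Least by blast

lemma walk_at_exit: "x \<in> F - e \<Longrightarrow> walk h r x (exit_time x) \<in> F - e"
  using LeastI_ex[OF walk_exits] walk_in unfolding exit_time_def by auto

text \<open>Since \<open>h\<close> and \<open>r\<close> are involutions, the curve from the exit runs back through the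
  same flags, with the roles of the two flags of each \<open>h\<close>-pair exchanged.\<close>

lemma walk_reverse:
  assumes x: "x \<in> F - e"
  shows "k < exit_time x \<Longrightarrow>
    walk h r (walk h r x (exit_time x)) k = h (walk h r x (exit_time x - Suc k))"
proof (induction k)
  case 0
  then obtain n where n: "exit_time x = Suc n" using gr0_implies_Suc by auto
  have "h (walk h r x n) \<in> F" using walk_in x matching_onD(1)[OF h] by auto
  then show ?case unfolding n by (simp add: walk_0 walk_Suc matching_onD(3)[OF r])
next
  case (Suc k)
  define n where "n = exit_time x - Suc (Suc k)"
  have n: "exit_time x - Suc k = Suc n" "exit_time x - Suc (Suc k) = n"
    using Suc.prems by (simp_all add: n_def)
  have "walk h r x (Suc n) \<in> F" "h (walk h r x n) \<in> F"
    using walk_in x matching_onD(1)[OF h] by auto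
  then have "r (h (h (walk h r x (Suc n)))) = h (walk h r x n)"
    using matching_onD(3)[OF h] matching_onD(3)[OF r] by (simp add: walk_Suc)
  then show ?case using Suc n by (simp add: walk_Suc)
qed

lemma new_rim_involution:
  assumes x: "x \<in> F - e"
  shows "new_rim h r e (new_rim h r e x) = x"
proof -
  let ?N = "exit_time x" and ?y = "walk h r x (exit_time x)"
  have at: "walk h r ?y ?N = x"
  proof (cases "?N")
    case 0
    then show ?thesis using x matching_onD(3)[OF r] by (simp add: walk_0)
  next
    case (Suc n)
    have "walk h r ?y n = h (walk h r x 0)" using walk_reverse[OF x, of n] Suc by simp
    then show ?thesis using x matching_onD[OF r] matching_onD(3)[OF h] unfolding Suc
      by (simp add: walk_0 walk_Suc)
  qed
  have "walk h r ?y k \<in> e" if "k < ?N" for k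
    using walk_reverse[OF x that] he walk_before_exit that by simp
  then have "exit_time ?y = ?N" unfolding exit_time_def[of ?y]
    using at x by (intro Least_equality) (auto simp: not_less[symmetric])
  then show ?thesis using at by (simp add: new_rim_walk)
qed

text \<open>A curve returning to its starting point would be its own reverse, and its middle would be
  a fixed point of \<open>h\<close> or of \<open>r\<close>.\<close>

lemma new_rim_no_fixpoint:
  assumes x: "x \<in> F - e"
  shows "new_rim h r e x \<noteq> x"
proof
  let ?N = "exit_time x"
  assume "new_rim h r e x = x"
  then have ret: "walk h r x ?N = x" by (simp add: new_rim_walk)
  have rev: "walk h r x k = h (walk h r x (?N - Suc k))" if "k < ?N" for k
    using walk_reverse[OF x that] ret by simp
  show False
  proof (cases "even ?N")
    case True
    then obtain m where m: "?N = 2 * m" by auto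
    show False
    proof (cases m)
      case 0
      then show False using ret m x matching_onD(2)[OF r] by (simp add: walk_0)
    next
      case (Suc n)
      then have "walk h r x (Suc n) = h (walk h r x n)" using rev[of "Suc n"] m by simp
      then show False
        using matching_onD(2)[OF r, of "h (walk h r x n)"] matching_onD(1)[OF h] walk_in x
        by (simp add: walk_Suc)
    qed
  next
    case False
    then obtain m where "?N = 2 * m + 1" by (auto elim: oddE)
    then have "walk h r x m = h (walk h r x m)" using rev[of m] by simp
    then show False using matching_onD(2)[OF h] walk_in x by (metis DiffD1)
  qed
qed

lemma matching_new_rim: "matching_on (F - e) (new_rim h r e)"
  using new_rim_involution new_rim_no_fixpoint walk_at_exit
  by (simp add: matching_on_def new_rim_walk)

context
  fixes Q :: "('f \<times> 'f) set"
  assumes Q: "Q \<subseteq> (F - e) \<times> (F - e)" "sym Q"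
begin

text \<open>The relation \<open>Q\<close> stands for whatever joins the flags outside \<open>e\<close>.\<close>

abbreviation "full \<equiv> steps {r} F \<union> steps {h} e \<union> Q"
abbreviation "reduced \<equiv> steps {new_rim h r e} (F - e) \<union> Q"

lemma sym_full: "sym full"
proof -
  have "matching_on e h" using matching_on_subset[OF h eF] he by blast
  then show ?thesis using r Q(2) by (intro sym_Un sym_steps) auto
qed

lemma sym_reduced: "sym reduced"
  using matching_new_rim Q(2) by (intro sym_Un sym_steps) auto

lemma reduced_imp_full:
  assumes "(x, y) \<in> reduced\<^sup>*"
  shows "(x, y) \<in> full\<^sup>*"
proof -
  have "(x, new_rim h r e x) \<in> full\<^sup>*" if x: "x \<in> F - e" for x
  proof -
    have "n \<le> exit_time x \<Longrightarrow> (x, walk h r x n) \<in> full\<^sup>*" for n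
    proof (induction n)
      case 0
      have "(x, r x) \<in> full" using x by (simp add: steps_def)
      then show ?case by (simp add: walk_0 r_into_rtrancl)
    next
      case (Suc n)
      then have w: "walk h r x n \<in> e" using walk_before_exit by simp
      then have "(walk h r x n, h (walk h r x n)) \<in> full"
        "(h (walk h r x n), walk h r x (Suc n)) \<in> full"
        using he eF by (auto simp: steps_def walk_Suc)
      then show ?case using Suc by (meson Suc_leD rtrancl.rtrancl_into_rtrancl)
    qed
    then show ?thesis by (simp add: new_rim_walk)
  qed
  then have "reduced \<subseteq> full\<^sup>*" by (auto simp: steps_def)
  then show ?thesis using assms by (meson rtrancl_subset_rtrancl subsetD)
qed

text \<open>The invariant of a path in \<open>full\<close>: inside \<open>e\<close> it is on the way along a curve that
  started at a flag outside \<open>e\<close> equivalent to the origin of the path.\<close>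

lemma full_imp_reduced:
  assumes "(x, y) \<in> full\<^sup>*" "x \<in> F - e" "y \<in> F - e"
  shows "(x, y) \<in> reduced\<^sup>*"
proof -
  define on_way where "on_way z \<longleftrightarrow> (\<exists>w n. w \<in> F - e \<and> (x, w) \<in> reduced\<^sup>* \<and> n < exit_time w
    \<and> (z = walk h r w n \<or> z = h (walk h r w n)))" for z
  have on_wayI: "on_way (walk h r w n)" "on_way (h (walk h r w n))"
    if "w \<in> F - e" "(x, w) \<in> reduced\<^sup>*" "n < exit_time w" for w n
    unfolding on_way_def using that by blast+
  have "if z \<in> e then on_way z else z \<in> F \<and> (x, z) \<in> reduced\<^sup>*" if "(x, z) \<in> full\<^sup>*" for z
    using that
  proof induction
    case base
    then show ?case using assms by auto
  next
    case (step y z)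
    have arrive: "if walk h r w n \<in> e then on_way (walk h r w n)
        else walk h r w n \<in> F \<and> (x, walk h r w n) \<in> reduced\<^sup>*"
      if w: "w \<in> F - e" "(x, w) \<in> reduced\<^sup>*" and n: "n \<le> exit_time w" for w n
    proof (cases "n < exit_time w")
      case True
      then show ?thesis using w walk_before_exit on_wayI(1) by simp
    next
      case False
      then have n: "n = exit_time w" using n by simp
      have "(w, walk h r w n) \<in> reduced" using w by (auto simp: steps_def n new_rim_walk)
      then show ?thesis using w walk_at_exit[of w] unfolding n by (auto intro: rtrancl_into_rtrancl)
    qed
    consider "y \<in> F" "z = r y" | "y \<in> e" "z = h y" | "(y, z) \<in> Q"
      using step.hyps(2) by (auto simp: steps_def)
    then show ?case
    proof cases
      case 1
      show ?thesis
      proof (cases "y \<in> e")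
        case False
        then show ?thesis using arrive[of y 0] step.IH 1 unfolding walk_0 by simp
      next
        case True
        then obtain w n where w: "w \<in> F - e" "(x, w) \<in> reduced\<^sup>*" "n < exit_time w"
          and y: "y = walk h r w n \<or> y = h (walk h r w n)"
          using step.IH by (auto simp: on_way_def)
        from y show ?thesis
        proof
          assume y: "y = walk h r w n"
          show ?thesis
          proof (cases n)
            case 0
            then have "z = w" using 1 y w matching_onD(3)[OF r] by (simp add: walk_0)
            with w show ?thesis by auto
          next
            case (Suc m)
            have "h (walk h r w m) \<in> F" using matching_onD(1)[OF h] walk_in w by auto
            then have "z = h (walk h r w m)"
              using 1 y Suc matching_onD(3)[OF r] by (simp add: walk_Suc)
            moreover from this have "z \<in> e" using he walk_before_exit[of m w] w Suc by auto
            ultimately show ?thesis using on_wayI(2)[of w m] w Suc by simp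
          qed
        next
          assume "y = h (walk h r w n)"
          then have "z = walk h r w (Suc n)" using 1 by (simp add: walk_Suc)
          then show ?thesis using arrive[of w "Suc n"] w by simp
        qed
      qed
    next
      case 2
      then obtain w n where w: "w \<in> F - e" "(x, w) \<in> reduced\<^sup>*" "n < exit_time w"
          and y: "y = walk h r w n \<or> y = h (walk h r w n)"
          using step.IH by (auto simp: on_way_def)
      then have "z = walk h r w n \<or> z = h (walk h r w n)"
        using 2 matching_onD(3)[OF h walk_in, of w n] by auto
      moreover have "z \<in> e" using he 2 by simp
      ultimately show ?thesis using on_wayI[OF w] by auto
    next
      case 3
      then have "y \<in> F - e" "z \<in> F - e" using Q by auto
      then show ?thesis using 3 step.IH by (auto intro: rtrancl_into_rtrancl)
    qed
  qed
  from this[OF assms(1)] assms(3) show ?thesis by auto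
qed

end

end

lemma closure_agree:
  assumes "R\<^sup>* `` {x} \<subseteq> A" "\<And>y z. y \<in> A \<Longrightarrow> (y, z) \<in> R \<longleftrightarrow> (y, z) \<in> R'"
  shows "R\<^sup>* `` {x} = R'\<^sup>* `` {x}"
proof -
  have "(x, y) \<in> R\<^sup>* \<Longrightarrow> (x, y) \<in> R'\<^sup>*" for y
  proof (induction rule: rtrancl_induct)
    case (step y z)
    then show ?case using assms by (meson Image_singleton_iff rtrancl.rtrancl_into_rtrancl subsetD)
  qed simp
  moreover have "(x, y) \<in> R'\<^sup>* \<Longrightarrow> (x, y) \<in> R\<^sup>*" for y
  proof (induction rule: rtrancl_induct)
    case (step y z)
    then show ?case using assms by (meson Image_singleton_iff rtrancl.rtrancl_into_rtrancl subsetD)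
  qed simp
  ultimately show ?thesis by auto
qed

lemma card_image_kernel_cong:
  assumes "\<And>x y. x \<in> A \<Longrightarrow> y \<in> A \<Longrightarrow> f x = f y \<longleftrightarrow> g x = g y"
  shows "card (f ` A) = card (g ` A)"
proof -
  have "bij_betw (\<lambda>v. g (SOME x. x \<in> A \<and> f x = v)) (f ` A) (g ` A)"
  proof -
    have some: "g (SOME x. x \<in> A \<and> f x = f a) = g a" if "a \<in> A" for a
      using someI[of "\<lambda>x. x \<in> A \<and> f x = f a" a] assms that by blast
    show ?thesis unfolding bij_betw_def
    proof
      show "inj_on (\<lambda>v. g (SOME x. x \<in> A \<and> f x = v)) (f ` A)"
        using some assms by (auto simp: inj_on_def)
      show "(\<lambda>v. g (SOME x. x \<in> A \<and> f x = v)) ` f ` A = g ` A"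
        using some by (force simp: image_image)
    qed
  qed
  then show ?thesis by (rule bij_betw_same_card)
qed

text \<open>Classes reaching beyond \<open>e\<close> survive the removal of \<open>e\<close>; the others are the closed
  curves inside \<open>e\<close>, which become isolated vertices.\<close>

lemma card_classes_remove:
  assumes fin: "finite F" and h: "matching_on F h" and r: "matching_on F r"
    and eF: "e \<subseteq> F" and he: "\<forall>x\<in>e. h x \<in> e"
    and Q: "Q \<subseteq> (F - e) \<times> (F - e)" "sym Q"
  shows "card (F // (steps {r} F \<union> steps {h} e \<union> Q)\<^sup>*)
    = card ((F - e) // (steps {new_rim h r e} (F - e) \<union> Q)\<^sup>*)
      + card {c \<in> orbits {h, r} F. c \<subseteq> e}"
proof -
  let ?T = "steps {r} F \<union> steps {h} e \<union> Q" and ?T' = "steps {new_rim h r e} (F - e) \<union> Q"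
  note symT = sym_full[OF fin h r eF he Q] and symT' = sym_reduced[OF fin h r eF he Q]
  let ?cl = "\<lambda>x. ?T\<^sup>* `` {x}" and ?cl' = "\<lambda>x. ?T'\<^sup>* `` {x}"
  let ?U = "steps {h, r} F"
  have self: "x \<in> ?cl x" for x by auto
  have split: "F // ?T\<^sup>* = ?cl ` (F - e) \<union> {c \<in> F // ?T\<^sup>*. c \<subseteq> e}"
  proof (intro equalityI subsetI)
    fix c assume c: "c \<in> F // ?T\<^sup>*"
    show "c \<in> ?cl ` (F - e) \<union> {c \<in> F // ?T\<^sup>*. c \<subseteq> e}"
    proof (cases "c \<subseteq> e")
      case True
      with c show ?thesis by simp
    next
      case False
      then obtain y where y: "y \<in> c" "y \<notin> e" by auto
      from c obtain x where x: "x \<in> F" "c = ?cl x" unfolding quotient_def by blast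
      have "(x, y) \<in> ?T\<^sup>*" using x y by auto
      moreover from this have "y \<in> F"
        using x(1)
      proof (induction rule: rtrancl_induct)
        case (step u v)
        then show ?case using Q eF he matching_onD(1)[OF r] by (auto simp: steps_def)
      qed
      ultimately show ?thesis using y x class_eq_iff[OF symT, of x y] by blast
    qed
  qed (auto simp: quotient_def)
  have "finite (F // ?T\<^sup>*)" using fin by (simp add: quotient_def)
  then have "card (F // ?T\<^sup>*) = card (?cl ` (F - e)) + card {c \<in> F // ?T\<^sup>*. c \<subseteq> e}"
    using fin by (subst split, intro card_Un_disjoint) auto
  also have "card (?cl ` (F - e)) = card (?cl' ` (F - e))"
  proof (rule card_image_kernel_cong)
    fix x y assume "x \<in> F - e" "y \<in> F - e"
    then show "?cl x = ?cl y \<longleftrightarrow> ?cl' x = ?cl' y"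
      unfolding class_eq_iff[OF symT] class_eq_iff[OF symT']
      using full_imp_reduced[OF fin h r eF he Q, of x y] reduced_imp_full[OF fin h r eF he Q, of x y]
      by blast
  qed
  also have "?cl' ` (F - e) = (F - e) // ?T'\<^sup>*" unfolding quotient_def by blast
  also have "{c \<in> F // ?T\<^sup>*. c \<subseteq> e} = {c \<in> orbits {h, r} F. c \<subseteq> e}"
  proof -
    have agree: "(y, z) \<in> ?T \<longleftrightarrow> (y, z) \<in> ?U" if "y \<in> e" for y z
      using that Q eF by (auto simp: steps_def)
    have "?cl x \<subseteq> e \<Longrightarrow> ?cl x = ?U\<^sup>* `` {x}" for x
      using closure_agree[of ?T x e ?U] agree by blast
    moreover have "?U\<^sup>* `` {x} \<subseteq> e \<Longrightarrow> ?cl x = ?U\<^sup>* `` {x}" for x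
      using closure_agree[of ?U x e ?T] agree by blast
    ultimately show ?thesis unfolding orbits_steps quotient_def by blast
  qed
  finally show ?thesis .
qed

section \<open>Circuits of a state\<close>

text \<open>The indeterminates serve as names for what is done to an edge: \<open>Ind_w\<close> pinches it,
  \<open>Ind_x\<close> contracts it, \<open>Ind_y\<close> deletes it, \<open>Ind_z\<close> Penrose-contracts it.  The value
  at \<open>Ind_t\<close> is a dummy.\<close>

definition resolution :: "'f ribbon \<Rightarrow> indet \<Rightarrow> ('f \<Rightarrow> 'f) set" where
  "resolution G a = (case a of Ind_w \<Rightarrow> {seg G, side G} | Ind_x \<Rightarrow> {side G} | Ind_y \<Rightarrow> {seg G}
     | Ind_z \<Rightarrow> {side G \<circ> seg G} | Ind_t \<Rightarrow> {})"

definition strands :: "'f ribbon \<Rightarrow> ('f set \<Rightarrow> indet) \<Rightarrow> ('f \<times> 'f) set" where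
  "strands G t = steps {rim G} (flags G) \<union> (\<Union>e\<in>edges G. steps (resolution G (t e)) e)"

definition num_circuits :: "'f ribbon \<Rightarrow> ('f set \<Rightarrow> indet) \<Rightarrow> nat" where
  "num_circuits G t = card (flags G // (strands G t)\<^sup>*) + isolated G"

lemma num_circuits_cong:
  assumes "\<And>e. e \<in> edges G \<Longrightarrow> t e = t' e"
  shows "num_circuits G t = num_circuits G t'"
  using assms by (simp add: num_circuits_def strands_def)

lemma matching_resolution:
  assumes G: "ribbon_graph G" and e: "e \<in> edges G" and h: "h \<in> resolution G a"
  shows "matching_on e h"
proof -
  have c: "seg G x \<in> e" "side G x \<in> e" if "x \<in> e" for x using edge_closed[OF G e that] by auto
  have F: "x \<in> flags G" if "x \<in> e" for x using that edge_subset[OF G e] by auto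
  have "side G (seg G x) \<noteq> x \<and> side G (seg G (side G (seg G x))) = x" if x: "x \<in> e" for x
    using c[OF x] F[OF x] F[OF c(1)[OF x]] side_neq_seg[OF G, of "seg G x"] seg_side[OF G, of "seg G x"]
      matching_onD(3)[OF match_seg[OF G]] matching_onD(3)[OF match_side[OF G]] by metis
  then have "matching_on e (side G \<circ> seg G)" using c by (simp add: matching_on_def)
  moreover have "matching_on e (seg G)" "matching_on e (side G)"
    using matching_on_subset[OF match_seg[OF G] edge_subset[OF G e]]
      matching_on_subset[OF match_side[OF G] edge_subset[OF G e]] c by auto
  ultimately show ?thesis using h by (cases a) (auto simp: resolution_def)
qed

lemma sym_strands:
  assumes G: "ribbon_graph G"
  shows "sym (strands G t)"
proof -
  have "sym (steps (resolution G (t e)) e)" if "e \<in> edges G" for e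
    using matching_resolution[OF G that] by (intro sym_steps) auto
  moreover have "sym (steps {rim G} (flags G))" using match_rim[OF G] by (intro sym_steps) auto
  ultimately show ?thesis unfolding strands_def by (auto intro!: sym_Un sym_UNION)
qed

text \<open>Pinching at every edge leaves each edge connected, hence the connected components as they are.\<close>

lemma num_components_eq_circuits:
  assumes G: "ribbon_graph G"
  shows "num_components G = num_circuits G (\<lambda>_. Ind_w)"
proof -
  have "steps {seg G, side G, rim G} (flags G) = strands G (\<lambda>_. Ind_w)"
    unfolding strands_def resolution_def steps_def Union_edges[OF G, symmetric] by auto
  then show ?thesis
    by (simp add: num_components_def num_circuits_def flag_components_def orbits_steps)
qed

lemma strands_all_contracted:
  assumes G: "ribbon_graph G"
  shows "strands G (\<lambda>_. Ind_x) = steps {side G, rim G} (flags G)"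
  unfolding strands_def resolution_def steps_def Union_edges[OF G, symmetric] by auto

lemma num_boundaries_eq_circuits:
  assumes G: "ribbon_graph G"
  shows "num_boundaries G = num_circuits G (\<lambda>_. Ind_x)"
  by (simp add: num_boundaries_def num_circuits_def flag_boundaries_def orbits_steps
      strands_all_contracted[OF G])

lemma steps_insert: "steps (insert h H) e = (\<lambda>x. (x, h x)) ` e \<union> steps H e"
  by (auto simp: steps_def)

text \<open>A half-twist at \<open>e\<close> replaces \<open>side\<close> on \<open>e\<close> by \<open>side \<circ> seg\<close>, so contracting
  the twisted edge is Penrose-contracting the original one.\<close>

lemma strands_petrial:
  assumes G: "ribbon_graph G" and A: "A \<subseteq> edges G" and t: "\<And>e. e \<in> A \<Longrightarrow> t e = Ind_x"
  shows "strands (partial_petrial G A) t = strands G (\<lambda>e. if e \<in> A then Ind_z else t e)"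
proof -
  have "steps (resolution (partial_petrial G A) (t e)) e
      = steps (resolution G (if e \<in> A then Ind_z else t e)) e" if e: "e \<in> edges G" for e
  proof (cases "e \<in> A")
    case True
    then have "x \<in> \<Union> A" if "x \<in> e" for x using that by auto
    then show ?thesis using True t by (auto simp: resolution_def steps_def petrial_side)
  next
    case False
    then have "side (partial_petrial G A) x = side G x" if "x \<in> e" for x
      using that e A edges_disjoint[OF G] by (auto simp: petrial_side)
    moreover have "seg G x \<in> e" if "x \<in> e" for x using edge_closed[OF G e that] by simp
    ultimately show ?thesis using False
      by (cases "t e") (simp_all add: resolution_def steps_insert cong: image_cong_simp)
  qed
  then show ?thesis unfolding strands_def edges_petrial[OF G A] by simp
qed

lemma num_circuits_petrial:
  assumes "ribbon_graph G" "A \<subseteq> edges G" "\<And>e. e \<in> A \<Longrightarrow> t e = Ind_x"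
  shows "num_circuits (partial_petrial G A) t = num_circuits G (\<lambda>e. if e \<in> A then Ind_z else t e)"
  using strands_petrial[OF assms] by (simp add: num_circuits_def)

lemma remove_along_sel [simp]:
  "flags (remove_along h G e) = flags G - e" "seg (remove_along h G e) = seg G"
  "side (remove_along h G e) = side G" "rim (remove_along h G e) = new_rim h (rim G) e"
  "isolated (remove_along h G e)
    = isolated G + card {c \<in> orbits {h, rim G} (flags G). c \<subseteq> e}"
  by (simp_all add: remove_along_def)

context
  fixes G :: "'f ribbon" and e h
  assumes G: "ribbon_graph G" and e: "e \<in> edges G" and h: "h \<in> {seg G, side G}"
begin

lemma match_h: "matching_on (flags G) h" and h_in: "\<forall>x\<in>e. h x \<in> e"
  using h match_seg[OF G] match_side[OF G] edge_closed[OF G e] by auto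

lemma ribbon_graph_remove_along: "ribbon_graph (remove_along h G e)"
proof -
  have out: "k x \<in> flags G - e" if "k \<in> {seg G, side G}" "x \<in> flags G - e" for k x
  proof -
    have k: "k x \<in> flags G" "k (k x) = x"
      using that match_seg[OF G] match_side[OF G] by (auto simp: matching_on_def)
    moreover have "k (k x) \<in> e" if "k x \<in> e"
      using edge_closed[OF G e that] \<open>k \<in> _\<close> by auto
    ultimately show ?thesis using that by auto
  qed
  have "matching_on (flags G - e) (seg G)" "matching_on (flags G - e) (side G)"
    using matching_on_subset[OF match_seg[OF G], of "flags G - e"] out[of "seg G"]
      matching_on_subset[OF match_side[OF G], of "flags G - e"] out[of "side G"] by auto
  moreover have "matching_on (flags G - e) (new_rim h (rim G) e)"
    by (rule matching_new_rim[OF finite_flags[OF G] match_h match_rim[OF G] edge_subset[OF G e] h_in])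
  ultimately show ?thesis using G unfolding ribbon_graph_def by simp
qed

lemma edges_remove_along: "edges (remove_along h G e) = edges G - {e}"
proof -
  have "edges (remove_along h G e) = edge_of G ` (flags G - e)"
    by (simp add: edges_eq[OF ribbon_graph_remove_along] edge_of_def)
  also have "\<dots> = edges G - {e}"
  proof (intro equalityI subsetI)
    fix d assume "d \<in> edge_of G ` (flags G - e)"
    then obtain x where "x \<in> flags G - e" "d = edge_of G x" by auto
    then show "d \<in> edges G - {e}" using edge_of_self[OF G, of x] by (auto simp: edges_eq[OF G])
  next
    fix d assume d: "d \<in> edges G - {e}"
    then obtain x where x: "x \<in> flags G" "d = edge_of G x" by (auto simp: edges_eq[OF G])
    then have "x \<notin> e" using edge_of_eq[OF G e, of x] d by auto
    with x show "d \<in> edge_of G ` (flags G - e)" by auto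
  qed
  finally show ?thesis .
qed

text \<open>Removing \<open>e\<close> along \<open>h\<close> carries out the resolution of \<open>e\<close> by \<open>h\<close>: circuits
  are shortened past \<open>e\<close>, and those confined to \<open>e\<close> turn into isolated vertices.\<close>

lemma num_circuits_remove_along:
  assumes t: "resolution G (t e) = {h}"
  shows "num_circuits (remove_along h G e) t = num_circuits G t"
proof -
  let ?Q = "\<Union>d\<in>edges G - {e}. steps (resolution G (t d)) d"
  have "resolution (remove_along h G e) a = resolution G a" for a
    by (simp add: resolution_def split: indet.split)
  then have new: "strands (remove_along h G e) t = steps {new_rim h (rim G) e} (flags G - e) \<union> ?Q"
    by (simp add: strands_def edges_remove_along)
  have "(\<Union>d\<in>edges G. steps (resolution G (t d)) d) = steps {h} e \<union> ?Q"
    using e t by auto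
  then have old: "strands G t = steps {rim G} (flags G) \<union> steps {h} e \<union> ?Q"
    by (simp add: strands_def Un_assoc)
  have Q1: "?Q \<subseteq> (flags G - e) \<times> (flags G - e)"
  proof -
    have "k x \<in> d" "d \<subseteq> flags G - e" if d: "d \<in> edges G - {e}" "k \<in> resolution G (t d)" "x \<in> d" for d k x
    proof -
      show "k x \<in> d" using matching_onD(1)[OF matching_resolution[OF G]] d by blast
      show "d \<subseteq> flags G - e" using d e edge_subset[OF G, of d] edges_disjoint[OF G, of d e] by auto
    qed
    then show ?thesis unfolding steps_def by blast
  qed
  have "sym (steps (resolution G (t d)) d)" if "d \<in> edges G - {e}" for d
    using matching_resolution[OF G] that by (intro sym_steps) blast
  then have Q2: "sym ?Q" by (intro sym_UNION) auto
  show ?thesis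
    using card_classes_remove[OF finite_flags[OF G] match_h match_rim[OF G] edge_subset[OF G e] h_in Q1 Q2]
    by (simp add: num_circuits_def new old)
qed

end

section \<open>The state sum\<close>

text \<open>Counting dark edges as pinched makes the first summand of the recursion a part of the sum:
  pinching a light edge moves it to \<open>D\<close> and leaves the ribbon graph unchanged.\<close>

definition state_sum :: "'f ep_ribbon \<Rightarrow> omega_poly" where
  "state_sum = (\<lambda>(G, D). \<Sum>s\<in>(edges G - D) \<rightarrow>\<^sub>E {Ind_w, Ind_x, Ind_y, Ind_z}.
     (\<Prod>e\<in>edges G - D. Ind (s e)) * Ind Ind_t ^ num_circuits G (\<lambda>e. if e \<in> D then Ind_w else s e))"

lemma sum_PiE_insert:
  fixes f :: "('i \<Rightarrow> 'j) \<Rightarrow> 'a::comm_monoid_add"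
  assumes "i \<notin> I" "finite I" "finite U"
  shows "sum f (insert i I \<rightarrow>\<^sub>E U) = (\<Sum>a\<in>U. \<Sum>s\<in>I \<rightarrow>\<^sub>E U. f (s(i := a)))"
proof -
  have "sum f (insert i I \<rightarrow>\<^sub>E U) = sum f ((\<lambda>(a, s). s(i := a)) ` (U \<times> (I \<rightarrow>\<^sub>E U)))"
    by (simp add: PiE_insert_eq)
  also have "\<dots> = (\<Sum>(a, s)\<in>U \<times> (I \<rightarrow>\<^sub>E U). f (s(i := a)))"
    by (subst sum.reindex[OF inj_combinator[OF assms(1)]]) (simp add: case_prod_unfold comp_def)
  finally show ?thesis by (simp add: sum.cartesian_product)
qed

lemma penrose_contract_props:
  assumes G: "ribbon_graph G" and e: "e \<in> edges G"
  shows "ribbon_graph (penrose_contract G e)" "edges (penrose_contract G e) = edges G - {e}"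
    "t e = Ind_z \<Longrightarrow> num_circuits (penrose_contract G e) t = num_circuits G t"
proof -
  let ?P = "partial_petrial G {e}"
  have A: "{e} \<subseteq> edges G" using e by simp
  note P = ribbon_graph_petrial[OF G A] and E = edges_petrial[OF G A]
  have eP: "e \<in> edges ?P" using e E by simp
  show "ribbon_graph (penrose_contract G e)" "edges (penrose_contract G e) = edges G - {e}"
    using ribbon_graph_remove_along[OF P eP, of "side ?P"] edges_remove_along[OF P eP, of "side ?P"] E
    by (simp_all add: penrose_contract_def contract_def)
  then have edges: "edges (penrose_contract G e) = edges G - {e}" by simp
  assume t: "t e = Ind_z"
  have "num_circuits (penrose_contract G e) t = num_circuits (penrose_contract G e) (t(e := Ind_x))"
    by (rule num_circuits_cong) (auto simp: edges)
  also have "\<dots> = num_circuits ?P (t(e := Ind_x))"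
    unfolding penrose_contract_def contract_def
    by (rule num_circuits_remove_along[OF P eP]) (simp_all add: resolution_def)
  also have "\<dots> = num_circuits G (\<lambda>d. if d \<in> {e} then Ind_z else (t(e := Ind_x)) d)"
    by (rule num_circuits_petrial[OF G A]) simp
  also have "\<dots> = num_circuits G t" using t by (intro num_circuits_cong) auto
  finally show "num_circuits (penrose_contract G e) t = num_circuits G t" .
qed

lemma contract_props:
  assumes G: "ribbon_graph G" and e: "e \<in> edges G"
  shows "ribbon_graph (contract G e)" "edges (contract G e) = edges G - {e}"
    "t e = Ind_x \<Longrightarrow> num_circuits (contract G e) t = num_circuits G t"
  unfolding contract_def
  using ribbon_graph_remove_along[OF G e, of "side G"] edges_remove_along[OF G e, of "side G"]
    num_circuits_remove_along[OF G e, of "side G" t] by (simp_all add: resolution_def)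

lemma delete_props:
  assumes G: "ribbon_graph G" and e: "e \<in> edges G"
  shows "ribbon_graph (delete G e)" "edges (delete G e) = edges G - {e}"
    "t e = Ind_y \<Longrightarrow> num_circuits (delete G e) t = num_circuits G t"
  unfolding delete_def
  using ribbon_graph_remove_along[OF G e, of "seg G"] edges_remove_along[OF G e, of "seg G"]
    num_circuits_remove_along[OF G e, of "seg G" t] by (simp_all add: resolution_def)

text \<open>The four summands of the recursion collect the states with the four possible values at
  \<open>e\<close>.\<close>

lemma is_Omega_state_sum: "is_Omega state_sum"
  unfolding is_Omega_def
proof (intro allI impI conjI ballI)
  fix K :: "'f ep_ribbon"
  assume K: "ep_ribbon_graph K"
  obtain G D where GD: "K = (G, D)" by (cases K)
  have G: "ribbon_graph G" and D: "D \<subseteq> edges G" using K by (auto simp: GD ep_ribbon_graph_def)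
  { assume "ep_edges K = {}"
    then have none: "edges G - D = {}" by (simp add: GD ep_edges_def)
    moreover from this have "num_circuits G (\<lambda>e. if e \<in> D then Ind_w else s e) = num_components G" for s
      unfolding num_components_eq_circuits[OF G] by (intro num_circuits_cong) auto
    ultimately show "state_sum K = Ind Ind_t ^ ep_components K"
      unfolding state_sum_def GD prod.case none by (simp add: ep_components_def) }
  fix e assume e: "e \<in> ep_edges K"
  then have eE: "e \<in> edges G" "e \<notin> D" by (auto simp: GD ep_edges_def)
  define L where "L = edges G - D - {e}"
  let ?U = "{Ind_w, Ind_x, Ind_y, Ind_z}"
  have L: "edges G - D = insert e L" "finite L" "e \<notin> L"
    using eE finite_edges[OF G] by (auto simp: L_def)
  define f where "f a s = (\<Prod>d\<in>L. Ind (s d))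
      * Ind Ind_t ^ num_circuits G (\<lambda>d. if d \<in> D then Ind_w else (s(e := a)) d)" for a s
  have "state_sum K = (\<Sum>a\<in>?U. \<Sum>s\<in>L \<rightarrow>\<^sub>E ?U. Ind a * f a s)"
  proof -
    have "(\<Prod>d\<in>insert e L. Ind ((s(e := a)) d)) = Ind a * (\<Prod>d\<in>L. Ind (s d))" for s a
    proof -
      have "(\<Prod>d\<in>L. Ind ((s(e := a)) d)) = (\<Prod>d\<in>L. Ind (s d))"
        using L(3) by (intro prod.cong) auto
      then show ?thesis unfolding prod.insert[OF L(2,3)] by (simp only: fun_upd_same)
    qed
    then show ?thesis unfolding state_sum_def GD prod.case L(1)
      by (subst sum_PiE_insert[OF L(3,2)]) (simp_all add: f_def mult.assoc)
  qed
  also have "\<dots> = (\<Sum>a\<in>?U. Ind a * (\<Sum>s\<in>L \<rightarrow>\<^sub>E ?U. f a s))" by (simp add: sum_distrib_left)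
  finally have expand: "state_sum K = (\<Sum>a\<in>?U. Ind a * (\<Sum>s\<in>L \<rightarrow>\<^sub>E ?U. f a s))" .
  have minor: "state_sum (G', D) = (\<Sum>s\<in>L \<rightarrow>\<^sub>E ?U. f a s)"
    if E': "edges G' = edges G - {e}" and n: "\<And>t. t e = a \<Longrightarrow> num_circuits G' t = num_circuits G t" for G' a
  proof -
    have L': "edges G' - D = L" using E' by (auto simp: L_def)
    have "num_circuits G' (\<lambda>d. if d \<in> D then Ind_w else s d)
        = num_circuits G (\<lambda>d. if d \<in> D then Ind_w else (s(e := a)) d)" for s
    proof -
      have "num_circuits G' (\<lambda>d. if d \<in> D then Ind_w else s d)
          = num_circuits G' (\<lambda>d. if d \<in> D then Ind_w else (s(e := a)) d)"
        by (rule num_circuits_cong) (auto simp: E')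
      then show ?thesis using n eE(2) by simp
    qed
    then show ?thesis unfolding state_sum_def prod.case L' f_def by simp
  qed
  have "state_sum (ep_pinch K e) = (\<Sum>s\<in>L \<rightarrow>\<^sub>E ?U. f Ind_w s)"
  proof -
    have L': "edges G - insert e D = L" by (auto simp: L_def)
    have st: "(\<lambda>d. if d \<in> insert e D then Ind_w else s d)
        = (\<lambda>d. if d \<in> D then Ind_w else (s(e := Ind_w)) d)" for s
      by auto
    show ?thesis unfolding state_sum_def ep_pinch_def GD prod.case L' f_def st ..
  qed
  moreover have "state_sum (ep_contract K e) = (\<Sum>s\<in>L \<rightarrow>\<^sub>E ?U. f Ind_x s)"
    unfolding ep_contract_def GD prod.case using contract_props[OF G eE(1)] by (intro minor) auto
  moreover have "state_sum (ep_delete K e) = (\<Sum>s\<in>L \<rightarrow>\<^sub>E ?U. f Ind_y s)"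
    unfolding ep_delete_def GD prod.case using delete_props[OF G eE(1)] by (intro minor) auto
  moreover have "state_sum (ep_penrose_contract K e) = (\<Sum>s\<in>L \<rightarrow>\<^sub>E ?U. f Ind_z s)"
    unfolding ep_penrose_contract_def GD prod.case using penrose_contract_props[OF G eE(1)]
    by (intro minor) auto
  ultimately show "state_sum K = Ind Ind_w * state_sum (ep_pinch K e)
      + Ind Ind_x * state_sum (ep_contract K e) + Ind Ind_y * state_sum (ep_delete K e)
      + Ind Ind_z * state_sum (ep_penrose_contract K e)"
    unfolding expand by (simp add: add.assoc)
qed

text \<open>Each operation leaves one light edge fewer, so the recursion determines all values.\<close>

lemma is_Omega_unique:
  assumes "is_Omega \<Phi>" "is_Omega \<Psi>" "ep_ribbon_graph K"
  shows "\<Phi> K = \<Psi> K"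
  using assms(3)
proof (induction "card (ep_edges K)" arbitrary: K rule: less_induct)
  case (less K)
  obtain G D where GD: "K = (G, D)" by (cases K)
  have G: "ribbon_graph G" and D: "D \<subseteq> edges G" using less.prems by (auto simp: GD ep_ribbon_graph_def)
  show ?case
  proof (cases "ep_edges K = {}")
    case True
    then show ?thesis using assms less.prems unfolding is_Omega_def by metis
  next
    case False
    then obtain e where e: "e \<in> ep_edges K" by auto
    then have eE: "e \<in> edges G" "e \<notin> D" by (auto simp: GD ep_edges_def)
    have fin: "finite (ep_edges K)" using finite_edges[OF G] by (simp add: GD ep_edges_def)
    have IH: "\<Phi> K' = \<Psi> K'" if "ep_ribbon_graph K'" "ep_edges K' = ep_edges K - {e}" for K'
      using less.hyps[OF _ that(1)] that(2) card_Diff1_less[OF fin e] by simp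
    have "\<Phi> (ep_pinch K e) = \<Psi> (ep_pinch K e)"
      by (rule IH) (use G D eE in \<open>auto simp: GD ep_pinch_def ep_ribbon_graph_def ep_edges_def\<close>)
    moreover have "\<Phi> (ep_contract K e) = \<Psi> (ep_contract K e)"
      by (rule IH)
        (use G D eE contract_props[OF G eE(1)] in \<open>auto simp: GD ep_contract_def ep_ribbon_graph_def ep_edges_def\<close>)
    moreover have "\<Phi> (ep_delete K e) = \<Psi> (ep_delete K e)"
      by (rule IH)
        (use G D eE delete_props[OF G eE(1)] in \<open>auto simp: GD ep_delete_def ep_ribbon_graph_def ep_edges_def\<close>)
    moreover have "\<Phi> (ep_penrose_contract K e) = \<Psi> (ep_penrose_contract K e)"
      by (rule IH)
        (use G D eE penrose_contract_props[OF G eE(1)] in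
          \<open>auto simp: GD ep_penrose_contract_def ep_ribbon_graph_def ep_edges_def\<close>)
    moreover have "\<Phi> K = Ind Ind_w * \<Phi> (ep_pinch K e) + Ind Ind_x * \<Phi> (ep_contract K e)
        + Ind Ind_y * \<Phi> (ep_delete K e) + Ind Ind_z * \<Phi> (ep_penrose_contract K e)"
      using assms(1) less.prems e unfolding is_Omega_def by blast
    moreover have "\<Psi> K = Ind Ind_w * \<Psi> (ep_pinch K e) + Ind Ind_x * \<Psi> (ep_contract K e)
        + Ind Ind_y * \<Psi> (ep_delete K e) + Ind Ind_z * \<Psi> (ep_penrose_contract K e)"
      using assms(2) less.prems e unfolding is_Omega_def by blast
    ultimately show ?thesis by simp
  qed
qed

lemma Omega_eq_state_sum:
  assumes "ep_ribbon_graph K"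
  shows "Omega K = state_sum K"
  unfolding Omega_def using is_Omega_state_sum is_Omega_unique[OF _ _ assms] by (intro the_equality) blast+

section \<open>Evaluation of the state sum\<close>

definition monomial_at :: "(indet \<Rightarrow> 'a::comm_ring_1) \<Rightarrow> (indet \<Rightarrow>\<^sub>0 nat) \<Rightarrow> 'a" where
  "monomial_at v m = (\<Prod>i\<in>Poly_Mapping.keys m. v i ^ Poly_Mapping.lookup m i)"

lemma monomial_at_add: "monomial_at v (m + n) = monomial_at v m * monomial_at v n"
proof -
  have ext: "monomial_at v k = (\<Prod>i\<in>K. v i ^ Poly_Mapping.lookup k i)"
    if "Poly_Mapping.keys k \<subseteq> K" "finite K" for k K
    unfolding monomial_at_def using that by (intro prod.mono_neutral_left) (auto simp: in_keys_iff)
  have "Poly_Mapping.keys (m + n) \<subseteq> Poly_Mapping.keys m \<union> Poly_Mapping.keys n"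
    by (rule keys_add)
  then show ?thesis
    using ext[of "m + n" "Poly_Mapping.keys m \<union> Poly_Mapping.keys n"]
      ext[of m "Poly_Mapping.keys m \<union> Poly_Mapping.keys n"]
      ext[of n "Poly_Mapping.keys m \<union> Poly_Mapping.keys n"]
    by (simp add: lookup_add power_add prod.distrib)
qed

lemma eval_omega_poly_add:
  "eval_omega_poly v (p + q) = eval_omega_poly v p + eval_omega_poly v q"
proof -
  have ext: "eval_omega_poly v r = (\<Sum>m\<in>K. of_int (Poly_Mapping.lookup r m) * monomial_at v m)"
    if "Poly_Mapping.keys r \<subseteq> K" "finite K" for r K
    unfolding eval_omega_poly_def monomial_at_def[symmetric]
    using that by (intro sum.mono_neutral_left) (auto simp: in_keys_iff)
  have "Poly_Mapping.keys (p + q) \<subseteq> Poly_Mapping.keys p \<union> Poly_Mapping.keys q"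
    by (rule keys_add)
  then show ?thesis
    using ext[of "p + q" "Poly_Mapping.keys p \<union> Poly_Mapping.keys q"]
      ext[of p "Poly_Mapping.keys p \<union> Poly_Mapping.keys q"]
      ext[of q "Poly_Mapping.keys p \<union> Poly_Mapping.keys q"]
    by (simp add: lookup_add distrib_right sum.distrib)
qed

lemma eval_omega_poly_sum: "eval_omega_poly v (sum f I) = (\<Sum>i\<in>I. eval_omega_poly v (f i))"
proof (induction I rule: infinite_finite_induct)
  case (insert i I)
  then show ?case by (simp add: eval_omega_poly_add)
qed (simp_all add: eval_omega_poly_def)

lemma eval_omega_poly_monomial: "eval_omega_poly v (Poly_Mapping.single m 1) = monomial_at v m"
  by (simp add: eval_omega_poly_def monomial_at_def)

text \<open>Every term of the state sum is a monomial with coefficient 1, and on monomials evaluation is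
  multiplicative because exponents add up.\<close>

lemma prod_Ind_monomial:
  assumes "finite E"
  obtains m where "(\<Prod>e\<in>E. Ind (a e)) = Poly_Mapping.single m 1"
    "\<And>v :: indet \<Rightarrow> 'b::comm_ring_1. monomial_at v m = (\<Prod>e\<in>E. v (a e))"
proof -
  have "\<exists>m. (\<Prod>e\<in>E. Ind (a e)) = Poly_Mapping.single m 1
      \<and> (\<forall>v :: indet \<Rightarrow> 'b. monomial_at v m = (\<Prod>e\<in>E. v (a e)))"
    using assms
  proof (induction E rule: finite_induct)
    case empty
    have "(\<Prod>e\<in>{}. Ind (a e)) = Poly_Mapping.single 0 1" by simp
    then show ?case by (intro exI[of _ 0]) (simp add: monomial_at_def)
  next
    case (insert e E)
    then obtain m where m: "(\<Prod>e\<in>E. Ind (a e)) = Poly_Mapping.single m 1"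
      "\<And>v :: indet \<Rightarrow> 'b. monomial_at v m = (\<Prod>e\<in>E. v (a e))" by blast
    have "monomial_at v (Poly_Mapping.single (a e) 1) = v (a e)" for v :: "indet \<Rightarrow> 'b"
      by (simp add: monomial_at_def)
    then show ?case using insert.hyps m
      by (intro exI[of _ "Poly_Mapping.single (a e) 1 + m"])
        (simp add: Ind_def mult_single monomial_at_add)
  qed
  with that show ?thesis by blast
qed

lemma eval_omega_poly_term:
  assumes "finite E"
  shows "eval_omega_poly v ((\<Prod>e\<in>E. Ind (a e)) * Ind i ^ c) = (\<Prod>e\<in>E. v (a e)) * v i ^ c"
proof -
  obtain m where m: "(\<Prod>e\<in>E. Ind (a e)) = Poly_Mapping.single m 1"
    "monomial_at v m = (\<Prod>e\<in>E. v (a e))"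
    using prod_Ind_monomial[OF assms] by metis
  obtain n where n: "(\<Prod>k<c. Ind i) = Poly_Mapping.single n 1" "monomial_at v n = (\<Prod>k<c. v i)"
    using prod_Ind_monomial[of "{..<c}" "\<lambda>_. i"] by (metis finite_lessThan)
  then have "Ind i ^ c = Poly_Mapping.single n 1" "monomial_at v n = v i ^ c" by simp_all
  with m show ?thesis by (simp add: mult_single eval_omega_poly_monomial monomial_at_add)
qed

lemma Omega_at_state_sum:
  assumes G: "ribbon_graph G"
  shows "Omega_at (of_ribbon G) w x y z t
    = (\<Sum>s\<in>edges G \<rightarrow>\<^sub>E {Ind_w, Ind_x, Ind_y, Ind_z}.
        (\<Prod>e\<in>edges G. case s e of Ind_w \<Rightarrow> w | Ind_x \<Rightarrow> x | Ind_y \<Rightarrow> y | Ind_z \<Rightarrow> z | Ind_t \<Rightarrow> t)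
          * t ^ num_circuits G s)"
proof -
  have "ep_ribbon_graph (of_ribbon G)" using G by (simp add: ep_ribbon_graph_def of_ribbon_def)
  then show ?thesis
    by (simp add: Omega_at_def Omega_eq_state_sum state_sum_def of_ribbon_def eval_omega_poly_sum
        eval_omega_poly_term finite_edges[OF G])
qed

section \<open>Signed sums over states\<close>

definition pinched_state :: "'e set \<Rightarrow> 'e set \<Rightarrow> 'e \<Rightarrow> indet" where
  "pinched_state S B e = (if e \<in> B then Ind_w else if e \<in> S then Ind_z else Ind_x)"

lemma sum_Pow_insert:
  fixes f :: "'b set \<Rightarrow> 'a::comm_monoid_add"
  assumes "i \<notin> E" "finite E"
  shows "sum f (Pow (insert i E)) = (\<Sum>S\<in>Pow E. f S + f (insert i S))"
proof -
  have "inj_on (insert i) (Pow E)" using assms(1) by (auto simp: inj_on_def)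
  then have "sum f (insert i ` Pow E) = (\<Sum>S\<in>Pow E. f (insert i S))" by (simp add: sum.reindex)
  moreover have "sum f (Pow E \<union> insert i ` Pow E) = sum f (Pow E) + sum f (insert i ` Pow E)"
    using assms by (intro sum.union_disjoint) auto
  ultimately show ?thesis by (simp add: Pow_insert sum.distrib)
qed

text \<open>The weights come from \<open>-2w + x + z = (x - w) + (z - w)\<close>.  Expanding the right-hand side,
  \<open>S\<close> collects the edges where the second bracket is chosen and \<open>B\<close> those where
  \<open>w\<close> is.\<close>

lemma sum_states_double:
  fixes F :: "('e \<Rightarrow> indet) \<Rightarrow> 'a::comm_ring_1" and v :: "indet \<Rightarrow> 'a"
  assumes "finite E" and v: "v Ind_w = -2" "v Ind_x = 1" "v Ind_y = 0" "v Ind_z = 1"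
  shows "(\<Sum>s\<in>E \<rightarrow>\<^sub>E {Ind_w, Ind_x, Ind_y, Ind_z}. (\<Prod>e\<in>E. v (s e)) * F s)
    = (\<Sum>S\<in>Pow E. \<Sum>B\<in>Pow E. (-1) ^ card B * F (restrict (pinched_state S B) E))"
  using assms(1)
proof (induction E arbitrary: F rule: finite_induct)
  case empty
  show ?case by (simp add: restrict_def)
next
  case (insert i E)
  let ?U = "{Ind_w, Ind_x, Ind_y, Ind_z}" and ?r = "\<lambda>S B. restrict (pinched_state S B) E"
  let ?R = "\<lambda>S B. restrict (pinched_state S B) (insert i E)"
  have weights: "(\<Prod>e\<in>insert i E. v ((s(i := a)) e)) = v a * (\<Prod>e\<in>E. v (s e))" for s a
  proof -
    have "(\<Prod>e\<in>E. v ((s(i := a)) e)) = (\<Prod>e\<in>E. v (s e))"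
      using insert.hyps by (intro prod.cong) auto
    then show ?thesis unfolding prod.insert[OF insert.hyps(1,2)] by (simp only: fun_upd_same)
  qed
  have "finite ?U" by simp
  have "(\<Sum>s\<in>insert i E \<rightarrow>\<^sub>E ?U. (\<Prod>e\<in>insert i E. v (s e)) * F s)
      = (\<Sum>a\<in>?U. \<Sum>s\<in>E \<rightarrow>\<^sub>E ?U. v a * ((\<Prod>e\<in>E. v (s e)) * F (s(i := a))))"
    unfolding sum_PiE_insert[OF insert.hyps(2,1) \<open>finite ?U\<close>] by (simp only: weights mult.assoc)
  also have "\<dots> = (\<Sum>a\<in>?U. v a * (\<Sum>S\<in>Pow E. \<Sum>B\<in>Pow E. (-1) ^ card B * F ((?r S B)(i := a))))"
    by (simp only: sum_distrib_left[symmetric] insert.IH)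
  also have "\<dots> = (\<Sum>S\<in>Pow E. \<Sum>B\<in>Pow E. (-1) ^ card B * F ((?r S B)(i := Ind_x))
      + (-1) ^ card B * F ((?r S B)(i := Ind_z)) - 2 * ((-1) ^ card B * F ((?r S B)(i := Ind_w))))"
    by (simp add: v sum.distrib sum_subtractf sum_distrib_left sum_negf)
  also have "\<dots> = (\<Sum>S\<in>Pow E. \<Sum>B\<in>Pow E.
      ((-1) ^ card B * F (?R S B) + (-1) ^ card (insert i B) * F (?R S (insert i B)))
      + ((-1) ^ card B * F (?R (insert i S) B)
        + (-1) ^ card (insert i B) * F (?R (insert i S) (insert i B))))"
  proof (intro sum.cong refl)
    fix S B assume "S \<in> Pow E" "B \<in> Pow E"
    then have i: "i \<notin> S" "i \<notin> B" "finite B" using insert.hyps finite_subset by auto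
    then have "?R S B = (?r S B)(i := Ind_x)" "?R S (insert i B) = (?r S B)(i := Ind_w)"
      "?R (insert i S) B = (?r S B)(i := Ind_z)" "?R (insert i S) (insert i B) = (?r S B)(i := Ind_w)"
      using insert.hyps by (auto simp: fun_eq_iff pinched_state_def)
    with i show "(-1) ^ card B * F ((?r S B)(i := Ind_x))
      + (-1) ^ card B * F ((?r S B)(i := Ind_z)) - 2 * ((-1) ^ card B * F ((?r S B)(i := Ind_w)))
      = ((-1) ^ card B * F (?R S B) + (-1) ^ card (insert i B) * F (?R S (insert i B)))
      + ((-1) ^ card B * F (?R (insert i S) B)
        + (-1) ^ card (insert i B) * F (?R (insert i S) (insert i B)))"
      by simp
  qed
  also have "\<dots> = (\<Sum>S\<in>Pow E. (\<Sum>B\<in>Pow (insert i E). (-1) ^ card B * F (?R S B))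
      + (\<Sum>B\<in>Pow (insert i E). (-1) ^ card B * F (?R (insert i S) B)))"
    unfolding sum_Pow_insert[OF insert.hyps(2,1)] sum.distrib ..
  also have "\<dots> = (\<Sum>S\<in>Pow (insert i E). \<Sum>B\<in>Pow (insert i E). (-1) ^ card B * F (?R S B))"
    unfolding sum_Pow_insert[OF insert.hyps(2,1), of "\<lambda>S. \<Sum>B\<in>Pow (insert i E). (-1) ^ card B * F (?R S B)"] ..
  finally show ?case .
qed

text \<open>The terms of \<open>S\<close> and \<open>insert b S\<close> cancel.\<close>

lemma signed_sum_vanishes:
  fixes g :: "'e set \<Rightarrow> 'a::comm_ring_1"
  assumes "finite E" "b \<in> E" and g: "\<And>S. S \<subseteq> E - {b} \<Longrightarrow> g (insert b S) = g S"
  shows "(\<Sum>S\<in>Pow E. (-1) ^ card S * g S) = 0"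
proof -
  have E: "E = insert b (E - {b})" "finite (E - {b})" using assms by auto
  have "(\<Sum>S\<in>Pow (insert b (E - {b})). (-1) ^ card S * g S)
      = (\<Sum>S\<in>Pow (E - {b}). (-1) ^ card S * g S + (-1) ^ card (insert b S) * g (insert b S))"
    by (rule sum_Pow_insert) (use E in auto)
  also have "\<dots> = 0"
  proof (rule sum.neutral, rule ballI)
    fix S assume "S \<in> Pow (E - {b})"
    then have "S \<subseteq> E - {b}" "finite S" "b \<notin> S" using E(2) finite_subset by auto
    then show "(-1) ^ card S * g S + (-1) ^ card (insert b S) * g (insert b S) = 0"
      using g by simp
  qed
  finally show ?thesis using E(1) by simp
qed

text \<open>The same expansion with a sign for each second bracket: \<open>w\<close> cancels from
  \<open>(x - w) - (z - w)\<close>.\<close>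

lemma signed_sum_states:
  fixes F :: "('e \<Rightarrow> indet) \<Rightarrow> 'a::comm_ring_1"
  assumes "finite E"
  shows "(\<Sum>S\<in>Pow E. (-1) ^ card S * (\<Sum>B\<in>Pow E. (-1) ^ card B * F (pinched_state S B)))
    = (\<Sum>S\<in>Pow E. (-1) ^ card S * F (pinched_state S {}))"
proof -
  have "(\<Sum>S\<in>Pow E. (-1) ^ card S * (\<Sum>B\<in>Pow E. (-1) ^ card B * F (pinched_state S B)))
      = (\<Sum>B\<in>Pow E. (-1) ^ card B * (\<Sum>S\<in>Pow E. (-1) ^ card S * F (pinched_state S B)))"
    unfolding sum_distrib_left by (subst sum.swap) (simp add: mult.left_commute)
  also have "\<dots> = (\<Sum>B\<in>{{}}. (-1) ^ card B * (\<Sum>S\<in>Pow E. (-1) ^ card S * F (pinched_state S B)))"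
  proof (rule sum.mono_neutral_right)
    show "\<forall>B\<in>Pow E - {{}}. (-1) ^ card B * (\<Sum>S\<in>Pow E. (-1) ^ card S * F (pinched_state S B)) = 0"
    proof
      fix B assume "B \<in> Pow E - {{}}"
      then obtain b where b: "b \<in> B" "b \<in> E" by auto
      have "pinched_state (insert b S) B = pinched_state S B" for S
        using b by (auto simp: fun_eq_iff pinched_state_def)
      then have "(\<Sum>S\<in>Pow E. (-1) ^ card S * F (pinched_state S B)) = 0"
        by (intro signed_sum_vanishes[OF assms b(2)]) simp
      then show "(-1) ^ card B * (\<Sum>S\<in>Pow E. (-1) ^ card S * F (pinched_state S B)) = 0" by simp
    qed
  qed (use assms in auto)
  finally show ?thesis by simp
qed

lemma penrose_eq_circuits:
  assumes G: "ribbon_graph G"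
  shows "penrose G l = (\<Sum>S\<in>Pow (edges G). (-1) ^ card S * l ^ num_circuits G (pinched_state S {}))"
  unfolding penrose_def
proof (intro sum.cong refl)
  fix S assume "S \<in> Pow (edges G)"
  then have S: "S \<subseteq> edges G" by simp
  have "num_boundaries (partial_petrial G S) = num_circuits G (\<lambda>e. if e \<in> S then Ind_z else Ind_x)"
    using num_boundaries_eq_circuits[OF ribbon_graph_petrial[OF G S]]
      num_circuits_petrial[OF G S, of "\<lambda>_. Ind_x"] by simp
  then show "(-1) ^ card S * l ^ num_boundaries (partial_petrial G S)
      = (-1) ^ card S * l ^ num_circuits G (pinched_state S {})"
    by (simp add: pinched_state_def[abs_def])
qed

lemma strandsI:
  "e \<in> edges G \<Longrightarrow> x \<in> e \<Longrightarrow> h \<in> resolution G (t e) \<Longrightarrow> (x, h x) \<in> strands G t"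
  unfolding strands_def steps_def by blast

text \<open>Every resolution is made up of steps along \<open>seg\<close> and \<open>side\<close>, all of which are
  available at a pinched edge.\<close>

lemma strands_coarsen:
  assumes G: "ribbon_graph G" and t: "\<And>e. e \<in> edges G \<Longrightarrow> t' e = t e \<or> t' e = Ind_w"
  shows "strands G t \<subseteq> (strands G t')\<^sup>*"
proof
  fix p assume "p \<in> strands G t"
  then consider "p \<in> steps {rim G} (flags G)"
    | e x h where "e \<in> edges G" "x \<in> e" "h \<in> resolution G (t e)" "p = (x, h x)"
    unfolding strands_def steps_def by auto
  then show "p \<in> (strands G t')\<^sup>*"
  proof cases
    case 1
    then have "p \<in> strands G t'" unfolding strands_def by simp
    then show ?thesis by (cases p) auto
  next
    case 2
    show ?thesis
    proof (cases "t' e = t e")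
      case True
      then show ?thesis using strandsI[of e G x h t'] 2 by (simp add: r_into_rtrancl)
    next
      case False
      then have w: "t' e = Ind_w" using t 2 by auto
      have st: "(y, seg G y) \<in> strands G t'" "(y, side G y) \<in> strands G t'" if "y \<in> e" for y
        using that w strandsI[OF 2(1), of y _ t'] by (simp_all add: resolution_def)
      have "seg G x \<in> e" using edge_closed[OF G 2(1,2)] by simp
      then have "(x, side G (seg G x)) \<in> (strands G t')\<^sup>*"
        using st[OF 2(2)] st(2)[of "seg G x"] by (meson r_into_rtrancl rtrancl_into_rtrancl)
      moreover have "h = seg G \<or> h = side G \<or> h = side G \<circ> seg G"
        using 2(3) by (cases "t e") (auto simp: resolution_def)
      ultimately show ?thesis using st[OF 2(2)] 2(4) by auto
    qed
  qed
qed

text \<open>The two strands at \<open>e\<close> lie on the single circuit \<open>c\<close>, so all four flags of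
  \<open>e\<close> are connected before \<open>e\<close> is pinched, and pinching merges nothing.\<close>

lemma num_circuits_pinch_self_contact:
  assumes G: "ribbon_graph G" and S: "S \<subseteq> edges G"
    and c: "c \<in> orbits {side (partial_petrial G S), rim G} (flags G)"
    and x: "x \<in> c" "seg G x \<in> c" and e: "e \<in> edges G" "x \<in> e" and B: "e \<notin> B"
  shows "num_circuits G (pinched_state S (insert e B)) = num_circuits G (pinched_state S B)"
proof -
  let ?P = "partial_petrial G S"
  let ?R = "strands G (pinched_state S B)" and ?R' = "strands G (pinched_state S (insert e B))"
  have P: "ribbon_graph ?P" using G S by (rule ribbon_graph_petrial)
  have m: "\<forall>h\<in>{side ?P, rim G}. matching_on (flags G) h"
    using match_side[OF P] match_rim[OF G] by simp
  have symR: "sym (?R\<^sup>*)" using sym_strands[OF G] by (rule sym_rtrancl)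
  have xF: "x \<in> flags G" "seg G x \<in> flags G" using orbit_subset[OF m c] x by auto
  have "steps {side ?P, rim G} (flags G) = strands G (pinched_state S {})"
    using strands_all_contracted[OF P] strands_petrial[OF G S, of "\<lambda>_. Ind_x"]
    by (simp add: pinched_state_def[abs_def])
  also have "\<dots> \<subseteq> ?R\<^sup>*" by (rule strands_coarsen[OF G]) (simp add: pinched_state_def)
  finally have fine: "steps {side ?P, rim G} (flags G) \<subseteq> ?R\<^sup>*" .
  have side: "(y, side ?P y) \<in> ?R\<^sup>*" if "y \<in> flags G" for y
    using that fine by (auto simp: steps_def)
  have "(x, seg G x) \<in> (steps {side ?P, rim G} (flags G))\<^sup>*"
  proof -
    obtain y where y: "c = (steps {side ?P, rim G} (flags G))\<^sup>* `` {y}"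
      using c unfolding orbits_steps quotient_def by auto
    have "sym ((steps {side ?P, rim G} (flags G))\<^sup>*)" using m by (intro sym_rtrancl sym_steps)
    then have "(x, y) \<in> (steps {side ?P, rim G} (flags G))\<^sup>*"
      using x(1) unfolding y by (auto dest: symD)
    then show ?thesis using x(2) unfolding y by (auto intro: rtrancl_trans)
  qed
  then have xs: "(x, seg G x) \<in> ?R\<^sup>*" using fine rtrancl_subset_rtrancl by blast
  have "(x, y) \<in> ?R\<^sup>*" if "y \<in> e" for y
  proof -
    have "y \<in> {x, seg G x, side ?P x, side ?P (seg G x)}"
    proof -
      have "y \<in> edge_of G x" using that edge_of_eq[OF G e] by simp
      moreover have "seg G (seg G x) = x" "seg G (side G x) = side G (seg G x)"
        using matching_onD(3)[OF match_seg[OF G] xF(1)] seg_side[OF G xF(1)] by auto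
      moreover have "seg G x \<in> \<Union> S \<longleftrightarrow> x \<in> \<Union> S" using Union_edges_closed(1)[OF G S xF(1)] .
      ultimately show ?thesis by (auto simp: edge_of_def petrial_side)
    qed
    then show ?thesis using xs side[OF xF(1)] rtrancl_trans[OF xs side[OF xF(2)]] by auto
  qed
  then have all: "(y, z) \<in> ?R\<^sup>*" if "y \<in> e" "z \<in> e" for y z
    using that symR by (meson rtrancl_trans symD)
  have "?R' \<subseteq> ?R\<^sup>*"
  proof
    fix p assume "p \<in> ?R'"
    then consider "p \<in> steps {rim G} (flags G)"
      | d y h where "d \<in> edges G" "y \<in> d" "h \<in> resolution G (pinched_state S (insert e B) d)" "p = (y, h y)"
      unfolding strands_def steps_def by auto
    then show "p \<in> ?R\<^sup>*"
    proof cases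
      case 1
      then have "p \<in> ?R" unfolding strands_def by simp
      then show ?thesis by (cases p) auto
    next
      case 2
      show ?thesis
      proof (cases "d = e")
        case True
        have "h y \<in> e" using matching_onD(1)[OF matching_resolution[OF G 2(1,3)] 2(2)] True by simp
        then show ?thesis using all 2 True by simp
      next
        case False
        then have "h \<in> resolution G (pinched_state S B d)" using 2(3) by (simp add: pinched_state_def)
        then show ?thesis using strandsI[OF 2(1,2)] 2(4) by (simp add: r_into_rtrancl)
      qed
    qed
  qed
  moreover have "?R \<subseteq> ?R'\<^sup>*" by (rule strands_coarsen[OF G]) (simp add: pinched_state_def)
  ultimately have "?R\<^sup>* = ?R'\<^sup>*" by (simp add: rtrancl_subset_rtrancl subset_antisym)
  then show ?thesis by (simp add: num_circuits_def)
qed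

text \<open>In an odd state some circuit meets itself at an edge \<open>e \<in> S\<close>; the sets \<open>B\<close> with and
  without \<open>e\<close> then cancel.\<close>

lemma plane_odd_pinch_sum:
  fixes l :: "'a::comm_ring_1"
  assumes G: "ribbon_graph G" and pl: "plane G" and S: "S \<subseteq> edges G" "odd (card S)"
  shows "(\<Sum>B\<in>Pow (edges G). (-1) ^ card B * l ^ num_circuits G (pinched_state S B)) = 0"
proof -
  obtain c x where c: "c \<in> orbits {side (partial_petrial G S), rim G} (flags G)"
    "x \<in> c" "x \<in> \<Union> S" "seg G x \<in> c"
    using even_if_no_self_contact[OF G pl S(1)] S(2) by blast
  then obtain e where e: "e \<in> S" "x \<in> e" by auto
  have eG: "e \<in> edges G" using e(1) S(1) by auto
  show ?thesis
  proof (rule signed_sum_vanishes[OF finite_edges[OF G] eG])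
    fix B assume "B \<subseteq> edges G - {e}"
    then have "e \<notin> B" by auto
    then show "l ^ num_circuits G (pinched_state S (insert e B)) = l ^ num_circuits G (pinched_state S B)"
      using num_circuits_pinch_self_contact[OF G S(1) c(1,2,4) eG e(2)] by simp
  qed
qed

theorem corollary4p5:
  fixes G :: "'f ribbon" and l :: "'a::comm_ring_1"
  assumes "ribbon_graph G" and "plane G"
  shows "Omega_at (of_ribbon G) (- 2) 1 0 1 l = penrose G l"
proof -
  let ?E = "edges G"
  define Q where "Q S = (\<Sum>B\<in>Pow ?E. (-1) ^ card B * l ^ num_circuits G (pinched_state S B))" for S
  define v where "v i = (case i of Ind_w \<Rightarrow> -2 | Ind_x \<Rightarrow> 1 | Ind_y \<Rightarrow> 0 | Ind_z \<Rightarrow> 1 | Ind_t \<Rightarrow> l)" for i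
  have fin: "finite ?E" using assms(1) by (rule finite_edges)
  have "Omega_at (of_ribbon G) (- 2) 1 0 1 l
      = (\<Sum>s\<in>?E \<rightarrow>\<^sub>E {Ind_w, Ind_x, Ind_y, Ind_z}. (\<Prod>e\<in>?E. v (s e)) * l ^ num_circuits G s)"
    unfolding Omega_at_state_sum[OF assms(1)] v_def ..
  also have "\<dots> = (\<Sum>S\<in>Pow ?E. \<Sum>B\<in>Pow ?E.
      (-1) ^ card B * l ^ num_circuits G (restrict (pinched_state S B) ?E))"
    by (rule sum_states_double[OF fin]) (simp_all add: v_def)
  also have "\<dots> = (\<Sum>S\<in>Pow ?E. Q S)"
  proof -
    have "num_circuits G (restrict t ?E) = num_circuits G t" for t
      by (rule num_circuits_cong) simp
    then show ?thesis by (simp add: Q_def)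
  qed
  also have "\<dots> = (\<Sum>S\<in>Pow ?E. (-1) ^ card S * Q S)"
  proof (intro sum.cong refl)
    fix S assume "S \<in> Pow ?E"
    then show "Q S = (-1) ^ card S * Q S"
      using plane_odd_pinch_sum[OF assms, of S l] by (cases "even (card S)") (simp_all add: Q_def)
  qed
  also have "\<dots> = (\<Sum>S\<in>Pow ?E. (-1) ^ card S * l ^ num_circuits G (pinched_state S {}))"
    unfolding Q_def by (rule signed_sum_states[OF fin])
  also have "\<dots> = penrose G l" by (rule penrose_eq_circuits[OF assms(1), symmetric])
  finally show ?thesis .
qed

end
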